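(* Let $p$ be a prime and $r\ge1$ an integer with $p^r\ge 3$. Let $C=\{C_0,\dots,C_{p^r}\}$ be the $(p^{2r},p^r-1,p^r-2)$ disjoint difference family in $(\mathbb{F}_{p^{2r}},+)$ given by the cosets in $\mathbb{F}_{p^{2r}}^*$ of the subgroup of order $p^r-1$ (index $p^r+1$). Let $E=\{(1+p\alpha)\mathcal{T}^* : \alpha\in\mathcal{T}\}\cup\{p\mathcal{T}^*\}$ be the disjoint difference family with the same parameters in the additive group of the Galois ring $\mathrm{GR}(p^2,r)$, where $\mathcal{T}$ is the Teichmüller set of $\mathrm{GR}(p^2,r)$ and $\mathcal{T}^*=\mathcal{T}\setminus\{0\}$. Then the $2$-$(p^{2r},p^r-1,p^r-2)$ designs $dev(C)$ and $dev(E)$ are isomorphic if $p=3$ and $r=1$, and they are nonisomorphic in every other case.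
   Context: Difference families and designs. For a subset $A$ of an abelian group $G$, $\Delta A$ is the multiset $\{a-a' : a,a'\in A, a\neq a'\}$. A collection of mutually disjoint $k$-subsets $D_1,\dots,D_b$ of an abelian group $G$ of order $v$ is a $(v,k,\lambda)$ disjoint difference family if each nonzero element of $G$ occurs exactly $\lambda$ times in the multiset union $\bigcup_i \Delta D_i$. The development $dev(D)$ of a family $D=\{D_1,\dots,D_b\}$ is the collection of all translates $D_i+g$ ($1\le i\le b$, $g\in G$); if $D$ is a $(v,k,\lambda)$ difference family then $dev(D)$, with point set $G$, is a $2$-$(v,k,\lambda)$ design, i.e. a collection of $k$-subsets (blocks) of a $v$-set of points such that each $2$-subset of points lies in exactly $\lambda$ blocks. Two designs are isomorphic if there is a bijection between their point sets that maps the collection of blocks of one onto the collection of blocks of the other. Finite field construction. Let $q$ be a prime power, $\alpha$ a generator of $\mathbb{F}_q^*$, and $ef=q-1$ with $e,f\ge2$. Put $C_i=\{\alpha^t : t\equiv i \pmod e\}$ for $i=0,\dots,e-1$. Then $C=\{C_0,\dots,C_{e-1}\}$ is a $(q,f,f-1)$ disjoint difference family in $(\mathbb{F}_q,+)$. Here $q=p^{2r}$, $e=p^r+1$, $f=p^r-1$. Galois rings. $\mathrm{GR}(p^2,r)=\mathbb{Z}_{p^2}[x]/\langle f(x)\rangle$, where $\mathbb{Z}_{p^2}$ is the ring of integers modulo $p^2$ and $f$ is a monic basic irreducible polynomial of degree $r$ (monic and irreducible modulo $p$); it is unique up to isomorphism. It contains an element $\xi$ of multiplicative order $p^r-1$,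 and $\mathcal{T}=\{0,1,\xi,\dots,\xi^{p^r-2}\}$ is its Teichmüller set (a system of representatives modulo the maximal ideal $p\,\mathrm{GR}(p^2,r)$). It is known that $E$ is a $(p^{2r},p^r-1,p^r-2)$ disjoint difference family in $(\mathrm{GR}(p^2,r),+)$. *)

theory Defs
  imports
    "HOL-Algebra.Algebra"
    "HOL-Number_Theory.Number_Theory"
    "HOL-Library.Multiset"
begin

text \<open>
  Abelian groups are written additively, so that the definitions below apply directly to the
  additive group of a ring.
\<close>

definition difference_multiset :: "('a, 'b) ring_scheme \<Rightarrow> 'a set \<Rightarrow> 'a multiset" where
  "difference_multiset G A =
     image_mset (\<lambda>(a, a'). a \<ominus>\<^bsub>G\<^esub> a') (mset_set {(a, a'). a \<in> A \<and> a' \<in> A \<and> a \<noteq> a'})"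

definition disjoint_difference_family ::
  "('a, 'b) ring_scheme \<Rightarrow> nat \<Rightarrow> nat \<Rightarrow> nat \<Rightarrow> 'a set set \<Rightarrow> bool" where
  "disjoint_difference_family G v k l \<D> \<longleftrightarrow>
     abelian_group G \<and> finite (carrier G) \<and> card (carrier G) = v \<and>
     (\<forall>D\<in>\<D>. D \<subseteq> carrier G \<and> card D = k) \<and>
     (\<forall>D\<in>\<D>. \<forall>D'\<in>\<D>. D \<noteq> D' \<longrightarrow> D \<inter> D' = {}) \<and>
     (\<forall>g \<in> carrier G - {\<zero>\<^bsub>G\<^esub>}. count (\<Sum>D\<in>\<D>. difference_multiset G D) g = l)"

text \<open>
  An incidence structure is a pair of a point set and a collection of blocks.  The collection is
  a multiset: a priori, different pairs of a base block and a group element may yield the same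
  translate, and such a block is counted with its multiplicity.
\<close>

type_synonym 'a incidence_structure = "'a set \<times> 'a set multiset"

definition two_design :: "nat \<Rightarrow> nat \<Rightarrow> nat \<Rightarrow> 'a incidence_structure \<Rightarrow> bool" where
  "two_design v k l S \<longleftrightarrow> (case S of (V, B) \<Rightarrow>
     finite V \<and> card V = v \<and>
     (\<forall>b \<in># B. b \<subseteq> V \<and> card b = k) \<and>
     (\<forall>P. P \<subseteq> V \<and> card P = 2 \<longrightarrow> size (filter_mset (\<lambda>b. P \<subseteq> b) B) = l))"

definition isomorphic_designs :: "'a incidence_structure \<Rightarrow> 'c incidence_structure \<Rightarrow> bool" where
  "isomorphic_designs S S' \<longleftrightarrow> (case S of (V, B) \<Rightarrow> case S' of (V', B') \<Rightarrow>
     (\<exists>\<phi>. bij_betw \<phi> V V' \<and> image_mset (\<lambda>b. \<phi> ` b) B = B'))"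

definition dev :: "('a, 'b) ring_scheme \<Rightarrow> 'a set set \<Rightarrow> 'a incidence_structure" where
  "dev G \<D> =
     (carrier G, image_mset (\<lambda>(D, g). D +>\<^bsub>G\<^esub> g) (mset_set (\<D> \<times> carrier G)))"

definition cyclotomic_classes :: "('a, 'b) ring_scheme \<Rightarrow> nat \<Rightarrow> 'a \<Rightarrow> 'a set set" where
  "cyclotomic_classes F e \<alpha> = {{\<alpha> [^]\<^bsub>F\<^esub> t | t :: nat. [t = i] (mod e)} | i. i < e}"

text \<open>
  An element of \<^term>\<open>UP R\<close> is its own coefficient function, so reducing the coefficients
  modulo \<^term>\<open>p\<close> turns a polynomial over the integers modulo the square of \<^term>\<open>p\<close> into a
  polynomial over the integers modulo \<^term>\<open>p\<close>.
\<close>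

definition monic_basic_irreducible :: "nat \<Rightarrow> nat \<Rightarrow> (nat \<Rightarrow> int) \<Rightarrow> bool" where
  "monic_basic_irreducible p r f \<longleftrightarrow>
     f \<in> carrier (UP (residue_ring (int p ^ 2))) \<and>
     deg (residue_ring (int p ^ 2)) f = r \<and> f r = 1 \<and>
     ring_irreducible\<^bsub>UP (residue_ring (int p))\<^esub> (\<lambda>i. f i mod int p)"

definition galois_ring :: "nat \<Rightarrow> (nat \<Rightarrow> int) \<Rightarrow> (nat \<Rightarrow> int) set ring" where
  "galois_ring p f =
     UP (residue_ring (int p ^ 2)) Quot (PIdl\<^bsub>UP (residue_ring (int p ^ 2))\<^esub> f)"

definition teichmuller_set :: "('a, 'b) ring_scheme \<Rightarrow> nat \<Rightarrow> 'a \<Rightarrow> 'a set" where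
  "teichmuller_set R n \<xi> = {\<zero>\<^bsub>R\<^esub>} \<union> {\<xi> [^]\<^bsub>R\<^esub> i | i :: nat. i < n}"

text \<open>Here \<^term>\<open>add_pow R p \<one>\<^bsub>R\<^esub>\<close> is the integer \<^term>\<open>p\<close> as an element of the ring.\<close>

definition teichmuller_family :: "('a, 'b) ring_scheme \<Rightarrow> nat \<Rightarrow> 'a set \<Rightarrow> 'a set set" where
  "teichmuller_family R p T =
     {(\<one>\<^bsub>R\<^esub> \<oplus>\<^bsub>R\<^esub> (add_pow R p \<one>\<^bsub>R\<^esub> \<otimes>\<^bsub>R\<^esub> \<alpha>)) <#\<^bsub>R\<^esub> (T - {\<zero>\<^bsub>R\<^esub>}) | \<alpha>. \<alpha> \<in> T}
     \<union> {add_pow R p \<one>\<^bsub>R\<^esub> <#\<^bsub>R\<^esub> (T - {\<zero>\<^bsub>R\<^esub>})}"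

end

theory Submission
  imports Defs
begin

text \<open>
  Both families are the set of all orbits on the nonzero elements of a finite commutative ring
  under multiplication by a group \<open>H\<close> of units such that \<open>1 - s\<close> is a unit for every
  \<open>s \<noteq> 1\<close> in \<open>H\<close>: the subgroup of order \<open>p\<^sup>r - 1\<close> in the field, the nonzero
  Teichmuller elements in the Galois ring. Writing a difference of two elements of one orbit as
  \<open>a (1 - s)\<close>, each nonzero element is obtained exactly once for each \<open>s \<noteq> 1\<close>, which gives
  the difference family property.

  If \<open>{0} \<union> H\<close> is closed under subtraction, it is a field, and the blocks are the punctured
  lines of an affine space over it; as soon as \<open>H\<close> has at least three elements, for each block
  \<open>B\<close> there is a unique point \<open>x\<close> such that \<open>B \<union> {x}\<close> with any point of \<open>B\<close> removed is
  again a block. This property is an isomorphism invariant. Conversely it forces \<open>{0} \<union> H\<close> to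
  be closed under subtraction: multiplication by \<open>H\<close> preserves the block \<open>H\<close> and hence fixes its
  point \<open>x\<close>, so \<open>x = 0\<close>, and likewise each block \<open>u H + g\<close> has the point \<open>g\<close>; so the block
  \<open>{0} \<union> H\<close> with \<open>1\<close> removed is a translate of an orbit by \<open>1\<close>, necessarily \<open>1 - H\<close>.
  In the Galois ring such a closed set would contain \<open>p\<close>, which is neither zero nor a unit.
\<close>

section \<open>Designs from difference families\<close>

text \<open>A translate \<open>D + g\<close> contains \<open>x\<close> and \<open>y\<close> exactly
  when \<open>(x - g, y - g)\<close> is a pair of elements of \<open>D\<close>, and the difference
  of that pair is \<open>x - y\<close> whatever \<open>g\<close> is. So the blocks through
  \<open>{x, y}\<close>, counted with multiplicity, correspond to the occurrences of
  \<open>x - y\<close> as a difference.\<close>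

lemma two_design_dev:
  assumes "disjoint_difference_family G v k l \<D>"
  shows "two_design v k l (dev G \<D>)"
proof -
  interpret abelian_group G
    using assms by (simp add: disjoint_difference_family_def)
  have fin: "finite (carrier G)" and card: "card (carrier G) = v"
    and sub: "\<And>D. D \<in> \<D> \<Longrightarrow> D \<subseteq> carrier G" and k: "\<And>D. D \<in> \<D> \<Longrightarrow> card D = k"
    and l: "\<And>g. g \<in> carrier G \<Longrightarrow> g \<noteq> \<zero>\<^bsub>G\<^esub> \<Longrightarrow>
      count (\<Sum>D\<in>\<D>. difference_multiset G D) g = l"
    using assms by (auto simp: disjoint_difference_family_def)
  have finD: "finite \<D>"
    by (rule finite_subset[of _ "Pow (carrier G)"]) (use sub fin in auto)
  have coset: "D +>\<^bsub>G\<^esub> g = (\<lambda>d. d \<oplus>\<^bsub>G\<^esub> g) ` D" for D g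
    by (auto simp: a_r_coset_def')
  have blocks: "D +>\<^bsub>G\<^esub> g \<subseteq> carrier G \<and> card (D +>\<^bsub>G\<^esub> g) = k"
    if "D \<in> \<D>" "g \<in> carrier G" for D g
  proof -
    have "inj_on (\<lambda>d. d \<oplus>\<^bsub>G\<^esub> g) D"
      using that sub by (intro inj_onI) (meson add.r_cancel subsetD)
    then show ?thesis
      using that sub[of D] k[of D] by (auto simp: coset card_image)
  qed
  have pairs: "size (filter_mset (\<lambda>b. P \<subseteq> b) (snd (dev G \<D>))) = l"
    if P: "P \<subseteq> carrier G" "card P = 2" for P
  proof -
    obtain x y where xy: "P = {x, y}" "x \<noteq> y"
      using P(2) by (meson card_2_iff)
    have x: "x \<in> carrier G" and y: "y \<in> carrier G"
      using P xy by auto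
    define S where "S = {(D, g). D \<in> \<D> \<and> g \<in> carrier G \<and> P \<subseteq> D +>\<^bsub>G\<^esub> g}"
    \<comment> \<open>\<open>T D\<close> holds the ordered pairs of \<open>D\<close> with difference
      \<open>x - y\<close>; its size is the multiplicity of \<open>x - y\<close> in the difference
      multiset of \<open>D\<close>.\<close>
    define T where "T = (\<lambda>D. {z \<in> {(a, a'). a \<in> D \<and> a' \<in> D \<and> a \<noteq> a'}.
      (case z of (a, a') \<Rightarrow> a \<ominus>\<^bsub>G\<^esub> a') = x \<ominus>\<^bsub>G\<^esub> y})"
    have finp: "finite {(a, a'). a \<in> D \<and> a' \<in> D \<and> a \<noteq> a'}" if "D \<in> \<D>" for D
    proof -
      have "finite D" using sub[OF that] fin finite_subset by blast
      then have "finite (D \<times> D)" by simp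
      then show ?thesis by (rule finite_subset[rotated]) auto
    qed
    have finT: "finite (T D)" if "D \<in> \<D>" for D
      using finp that by (auto simp: T_def)
    have *: "a = (x \<ominus>\<^bsub>G\<^esub> y) \<oplus>\<^bsub>G\<^esub> a'"
      if "a \<in> carrier G" "a' \<in> carrier G" "a \<ominus>\<^bsub>G\<^esub> a' = x \<ominus>\<^bsub>G\<^esub> y" for a a'
    proof -
      have "(a \<ominus>\<^bsub>G\<^esub> a') \<oplus>\<^bsub>G\<^esub> a' = a"
        using that(1,2) by (simp add: minus_eq a_assoc l_neg)
      then show ?thesis using that(3) by simp
    qed
    \<comment> \<open>A pair \<open>(a, a')\<close> determines the translation as
      \<open>y - a'\<close>; since \<open>a - a' = x - y\<close>, this equals
      \<open>x - a\<close>.\<close>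
    have bij: "bij_betw (\<lambda>(D, g). (D, (x \<ominus>\<^bsub>G\<^esub> g, y \<ominus>\<^bsub>G\<^esub> g))) S (SIGMA D:\<D>. T D)"
    proof (rule bij_betw_byWitness[where f' = "\<lambda>(D, (a, a')). (D, y \<ominus>\<^bsub>G\<^esub> a')"])
      show "\<forall>z\<in>S. (\<lambda>(D, (a, a')). (D, y \<ominus>\<^bsub>G\<^esub> a')) ((\<lambda>(D, g). (D, (x \<ominus>\<^bsub>G\<^esub> g, y \<ominus>\<^bsub>G\<^esub> g))) z) = z"
        using y by (auto simp: S_def minus_eq minus_add a_ac r_neg2 r_neg1 r_neg)
    next
      show "\<forall>z\<in>SIGMA D:\<D>. T D. (\<lambda>(D, g). (D, (x \<ominus>\<^bsub>G\<^esub> g, y \<ominus>\<^bsub>G\<^esub> g)))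
          ((\<lambda>(D, (a, a')). (D, y \<ominus>\<^bsub>G\<^esub> a')) z) = z"
      proof
        fix z assume "z \<in> (SIGMA D:\<D>. T D)"
        then obtain D a a' where z: "z = (D, a, a')" "D \<in> \<D>" and T: "(a, a') \<in> T D"
          by auto
        then have a: "a \<in> carrier G" "a' \<in> carrier G" "a \<ominus>\<^bsub>G\<^esub> a' = x \<ominus>\<^bsub>G\<^esub> y"
          using sub by (auto simp: T_def)
        have "x \<ominus>\<^bsub>G\<^esub> (y \<ominus>\<^bsub>G\<^esub> a') = (x \<ominus>\<^bsub>G\<^esub> y) \<oplus>\<^bsub>G\<^esub> a'"
          using x y a by (simp add: minus_eq minus_add a_assoc)
        then have 1: "x \<ominus>\<^bsub>G\<^esub> (y \<ominus>\<^bsub>G\<^esub> a') = a" using *[OF a] by simp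
        have 2: "y \<ominus>\<^bsub>G\<^esub> (y \<ominus>\<^bsub>G\<^esub> a') = a'"
          using y a by (simp add: minus_eq minus_add r_neg2 flip: a_assoc) (simp add: r_neg)
        show "(\<lambda>(D, g). (D, (x \<ominus>\<^bsub>G\<^esub> g, y \<ominus>\<^bsub>G\<^esub> g)))
          ((\<lambda>(D, (a, a')). (D, y \<ominus>\<^bsub>G\<^esub> a')) z) = z"
          using 1 2 by (simp add: z)
      qed
    next
      show "(\<lambda>(D, g). (D, (x \<ominus>\<^bsub>G\<^esub> g, y \<ominus>\<^bsub>G\<^esub> g))) ` S \<subseteq> (SIGMA D:\<D>. T D)"
      proof
        fix z assume "z \<in> (\<lambda>(D, g). (D, (x \<ominus>\<^bsub>G\<^esub> g, y \<ominus>\<^bsub>G\<^esub> g))) ` S"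
        then obtain D g where z: "z = (D, x \<ominus>\<^bsub>G\<^esub> g, y \<ominus>\<^bsub>G\<^esub> g)" "(D, g) \<in> S"
          by auto
        then have D: "D \<in> \<D>" and g: "g \<in> carrier G" and "x \<in> D +>\<^bsub>G\<^esub> g" "y \<in> D +>\<^bsub>G\<^esub> g"
          by (auto simp: S_def xy)
        then obtain d d' where d: "d \<in> D" "x = d \<oplus>\<^bsub>G\<^esub> g" "d' \<in> D" "y = d' \<oplus>\<^bsub>G\<^esub> g"
          by (auto simp: coset)
        then have dc: "d \<in> carrier G" "d' \<in> carrier G"
          using D sub by auto
        have eq: "x \<ominus>\<^bsub>G\<^esub> g = d" "y \<ominus>\<^bsub>G\<^esub> g = d'"
          using d dc g by (simp_all add: minus_eq a_assoc r_neg)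
        have "d \<noteq> d'" using d xy by auto
        moreover have "d \<ominus>\<^bsub>G\<^esub> d' = x \<ominus>\<^bsub>G\<^esub> y"
          unfolding d(2,4) using dc g
          by (simp add: minus_eq minus_add a_assoc) (metis a_assoc a_comm a_inv_closed l_zero r_neg)
        ultimately show "z \<in> (SIGMA D:\<D>. T D)"
          using D d eq z(1) by (simp add: T_def)
      qed
    next
      show "(\<lambda>(D, (a, a')). (D, y \<ominus>\<^bsub>G\<^esub> a')) ` (SIGMA D:\<D>. T D) \<subseteq> S"
      proof
        fix z assume "z \<in> (\<lambda>(D, (a, a')). (D, y \<ominus>\<^bsub>G\<^esub> a')) ` (SIGMA D:\<D>. T D)"
        then obtain D a a' where z: "z = (D, y \<ominus>\<^bsub>G\<^esub> a')" and D: "D \<in> \<D>" and T: "(a, a') \<in> T D"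
          by auto
        then have a: "a \<in> carrier G" "a' \<in> carrier G" "a \<ominus>\<^bsub>G\<^esub> a' = x \<ominus>\<^bsub>G\<^esub> y" "a \<in> D" "a' \<in> D"
          using sub by (auto simp: T_def)
        have "a \<oplus>\<^bsub>G\<^esub> (y \<ominus>\<^bsub>G\<^esub> a') = (a \<ominus>\<^bsub>G\<^esub> a') \<oplus>\<^bsub>G\<^esub> y"
          using x y a(1,2) by (simp add: minus_eq a_ac)
        also have "\<dots> = x"
          unfolding a(3) using x y by (simp add: minus_eq a_assoc l_neg)
        finally have 1: "x = a \<oplus>\<^bsub>G\<^esub> (y \<ominus>\<^bsub>G\<^esub> a')" by simp
        have 2: "y = a' \<oplus>\<^bsub>G\<^esub> (y \<ominus>\<^bsub>G\<^esub> a')"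
          using y a(1,2) by (simp add: minus_eq a_lcomm[of a' y] r_neg)
        have "x \<in> D +>\<^bsub>G\<^esub> (y \<ominus>\<^bsub>G\<^esub> a')" "y \<in> D +>\<^bsub>G\<^esub> (y \<ominus>\<^bsub>G\<^esub> a')"
          unfolding coset using 1 2 a by blast+
        then show "z \<in> S"
          using D y a z by (auto simp: S_def xy)
      qed
    qed
    have "size (filter_mset (\<lambda>b. P \<subseteq> b) (snd (dev G \<D>))) = card S"
    proof -
      have "S = {z \<in> \<D> \<times> carrier G. P \<subseteq> (case z of (D, g) \<Rightarrow> D +>\<^bsub>G\<^esub> g)}"
        by (auto simp: S_def)
      then show ?thesis
        using fin finD by (simp add: dev_def filter_mset_image_mset)
    qed
    also have "\<dots> = card (SIGMA D:\<D>. T D)"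
      using bij by (rule bij_betw_same_card)
    also have "\<dots> = (\<Sum>D\<in>\<D>. card (T D))"
      using finD finT by (simp add: card_SigmaI)
    also have "\<dots> = count (\<Sum>D\<in>\<D>. difference_multiset G D) (x \<ominus>\<^bsub>G\<^esub> y)"
      unfolding count_sum difference_multiset_def T_def
      using finp by (intro sum.cong refl) (simp add: count_image_mset_eq_card_vimage)
    also have "\<dots> = l"
    proof (rule l)
      show "x \<ominus>\<^bsub>G\<^esub> y \<noteq> \<zero>\<^bsub>G\<^esub>"
        using *[OF x y refl] x y xy by auto
    qed (use x y in auto)
    finally show ?thesis .
  qed
  show ?thesis
    unfolding two_design_def using fin card pairs blocks finD
    by (auto simp: dev_def)
qed

section \<open>Designs with blocks of size two\<close>

text \<open>A two-element block containing a pair is that pair, so the number of blocks through a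
  pair is its multiplicity as a block.\<close>

lemma count_block_size_2:
  assumes "two_design v 2 l (W, A)"
  shows "count A P = (if P \<subseteq> W \<and> card P = 2 then l else 0)"
proof (cases "P \<subseteq> W \<and> card P = 2")
  case True
  have "P \<subseteq> b \<longleftrightarrow> b = P" if "b \<in># A" for b
  proof -
    have "b \<subseteq> W" "card b = 2" "finite W"
      using assms that by (auto simp: two_design_def)
    then show ?thesis
      using True card_subset_eq[of b P] finite_subset[of b W] by auto
  qed
  then have "filter_mset (\<lambda>b. P \<subseteq> b) A = filter_mset (\<lambda>b. b = P) A"
    by (rule filter_mset_cong0)
  moreover have "size (filter_mset (\<lambda>b. P \<subseteq> b) A) = l"
    using True assms by (auto simp: two_design_def)
  ultimately show ?thesis
    using True by (simp add: filter_eq_replicate_mset)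
next
  case False
  then show ?thesis
    using assms by (auto simp: two_design_def count_eq_zero_iff)
qed

text \<open>Each of the two designs consists of \<open>l\<close> copies of every pair of points, so
  every bijection between the point sets is an isomorphism. This settles the case
  \<open>p = 3\<close>, \<open>r = 1\<close>.\<close>

lemma isomorphic_designs_block_size_2:
  assumes "two_design v 2 l S" "two_design v 2 l S'"
  shows "isomorphic_designs S S'"
proof -
  obtain V B V' B' where S: "S = (V, B)" "S' = (V', B')"
    by fastforce
  have V: "finite V" "finite V'" "card V = card V'"
    using assms by (auto simp: two_design_def S)
  then obtain \<phi> where \<phi>: "bij_betw \<phi> V V'"
    using finite_same_card_bij by blast
  have inj: "inj_on (image \<phi>) (Pow V)"
    using \<phi> by (simp add: bij_betw_imp_inj_on inj_on_image_Pow)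
  have "count (image_mset (image \<phi>) B) P = count B' P" for P
  proof (cases "P \<subseteq> V'")
    case True
    define Q where "Q = inv_into V \<phi> ` P"
    have Q: "Q \<subseteq> V" "\<phi> ` Q = P" 
      using True \<phi> unfolding Q_def bij_betw_def
      by (auto simp: image_inv_into_cancel inv_into_into)
    have "card Q = card P"
      using Q \<phi> by (metis bij_betw_imp_inj_on card_image inj_on_subset)
    have "count (image_mset (image \<phi>) B) (image \<phi> Q) = count B Q"
    proof -
      \<comment> \<open>All blocks lie in \<open>Pow V\<close>, where \<open>image \<phi>\<close> is
        injective, so \<open>Q\<close> is the only possible block with image
        \<open>P\<close>.\<close>
      have "set_mset B \<subseteq> Pow V"
        using assms(1) by (auto simp: two_design_def S)
      then have "image \<phi> -` {\<phi> ` Q} \<inter> set_mset B = {Q} \<inter> set_mset B"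
        using inj Q(1) unfolding inj_on_def by blast
      then show ?thesis
        by (cases "Q \<in># B") (simp_all add: count_image_mset not_in_iff)
    qed
    then show ?thesis
      using count_block_size_2[of v l V B Q] count_block_size_2[of v l V' B' P] assms True Q \<open>card Q = card P\<close> by (simp add: S)
  next
    case False
    have "P \<notin> image \<phi> ` set_mset B"
      using False \<phi> assms(1) by (auto simp: two_design_def S bij_betw_def)
    then have "count (image_mset (image \<phi>) B) P = 0"
      by (metis count_eq_zero_iff set_image_mset)
    then show ?thesis
      using count_block_size_2[of v l V' B' P] assms False by (simp add: S)
  qed
  then have "image_mset (image \<phi>) B = B'"
    by (rule multiset_eqI)
  then show ?thesis
    using \<phi> by (auto simp: isomorphic_designs_def S)
qed

section \<open>Completions of a block, an isomorphism invariant\<close>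

definition completion :: "'a incidence_structure \<Rightarrow> 'a set \<Rightarrow> 'a \<Rightarrow> bool" where
  "completion S B x \<longleftrightarrow>
     x \<in> fst S \<and> x \<notin> B \<and> (\<forall>y\<in>B. insert x B - {y} \<in># snd S)"

definition uniquely_completable :: "'a incidence_structure \<Rightarrow> bool" where
  "uniquely_completable S \<longleftrightarrow> (\<forall>B \<in># snd S. \<exists>!x. completion S B x)"

text \<open>Injectivity lets the removal of a point commute with taking images. The map is only
  asked to send points to points and blocks to blocks, so that the lemma covers an isomorphism, its
  inverse and an automorphism alike.\<close>

lemma completion_image:
  assumes "inj_on \<phi> (fst S)" "\<phi> ` fst S \<subseteq> fst S'" "\<And>b. b \<in># snd S \<Longrightarrow> \<phi> ` b \<in># snd S'"
    and "B \<subseteq> fst S" "completion S B x"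
  shows "completion S' (\<phi> ` B) (\<phi> x)"
proof -
  have x: "x \<in> fst S" "x \<notin> B" "\<And>y. y \<in> B \<Longrightarrow> insert x B - {y} \<in># snd S"
    using assms(5) by (auto simp: completion_def)
  have "insert (\<phi> x) (\<phi> ` B) - {\<phi> y} \<in># snd S'" if "y \<in> B" for y
  proof -
    have "inj_on \<phi> (insert x B)"
      using assms(1,4) x(1) by (meson inj_on_subset insert_subset)
    then have "insert (\<phi> x) (\<phi> ` B) - {\<phi> y} = \<phi> ` (insert x B - {y})"
      using that by (auto simp: inj_on_def)
    then show ?thesis using assms(3) x(3) that by simp
  qed
  moreover have "\<phi> x \<notin> \<phi> ` B"
    using assms(1,4) x by (meson inj_on_image_mem_iff)
  ultimately show ?thesis
    using assms(2) x by (auto simp: completion_def)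
qed

text \<open>Carrying the completion along the isomorphism gives existence; carrying any completion
  back along the inverse gives uniqueness.\<close>

lemma uniquely_completable_isomorphic:
  assumes "isomorphic_designs S S'" "uniquely_completable S"
    and "\<And>b. b \<in># snd S \<Longrightarrow> b \<subseteq> fst S"
  shows "uniquely_completable S'"
proof -
  obtain \<phi> where \<phi>: "bij_betw \<phi> (fst S) (fst S')" "image_mset (image \<phi>) (snd S) = snd S'"
    using assms(1) by (auto simp: isomorphic_designs_def)
  define \<psi> where "\<psi> = inv_into (fst S) \<phi>"
  have \<psi>: "bij_betw \<psi> (fst S') (fst S)"
    using \<phi>(1) bij_betw_inv_into unfolding \<psi>_def by blast
  have \<psi>\<phi>: "\<psi> ` \<phi> ` b = b" if "b \<subseteq> fst S" for b
    using that \<phi>(1) by (simp add: \<psi>_def bij_betw_imp_inj_on inv_into_image_cancel)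
  have blocks': "b \<in># snd S' \<longleftrightarrow> (\<exists>c. c \<in># snd S \<and> b = \<phi> ` c)" for b
    by (auto simp flip: \<phi>(2))
  show ?thesis
    unfolding uniquely_completable_def
  proof
    fix B' assume "B' \<in># snd S'"
    then obtain B where B: "B \<in># snd S" "B' = \<phi> ` B"
      using blocks' by auto
    then have BV: "B \<subseteq> fst S" "B' \<subseteq> fst S'"
      using assms(3) \<phi>(1) by (auto simp: bij_betw_def)
    obtain x where x: "completion S B x" "\<And>z. completion S B z \<Longrightarrow> z = x"
      using assms(2) B(1) unfolding uniquely_completable_def by metis
    have "completion S' B' (\<phi> x)"
      unfolding B(2) using \<phi>(1) x(1) BV(1) blocks'
      by (intro completion_image) (auto simp: bij_betw_def)
    moreover have "z = \<phi> x" if "completion S' B' z" for z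
    proof -
      have "completion S (\<psi> ` B') (\<psi> z)"
        using \<psi> that BV(2) blocks' \<psi>\<phi> assms(3)
        by (intro completion_image[where S = S']) (auto simp: bij_betw_def)
      then have "\<psi> z = x"
        using x(2) \<psi>\<phi>[OF BV(1)] B(2) by simp
      moreover have "\<phi> (\<psi> z) = z"
        using that \<phi>(1) unfolding \<psi>_def completion_def
        by (metis bij_betw_inv_into_right)
      ultimately show ?thesis by simp
    qed
    ultimately show "\<exists>!x. completion S' B' x" by blast
  qed
qed

section \<open>Difference families from orbits of units\<close>

text \<open>The setting shared by the field and the Galois ring. As \<open>x s = x\<close> means
  \<open>x (1 - s) = 0\<close>, the last assumption makes each nontrivial element of
  \<open>H\<close> act without nonzero fixed points; it also makes \<open>a (1 - s) = g\<close>
  uniquely solvable for \<open>a\<close>.\<close>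

locale unit_orbits = cring R for R (structure) +
  fixes H :: "'a set"
  assumes finite_carrier: "finite (carrier R)"
    and subgroup_H: "subgroup H (units_of R)"
    and diff_unit: "s \<in> H \<Longrightarrow> s \<noteq> \<one> \<Longrightarrow> \<one> \<ominus> s \<in> Units R"
begin

definition orbits :: "'a set set" where
  "orbits = (\<lambda>x. x <# H) ` (carrier R - {\<zero>})"

lemmas [simp] = Units_closed

lemma H_Units: "h \<in> H \<Longrightarrow> h \<in> Units R"
  using subgroup.subset[OF subgroup_H] by (auto simp: units_of_carrier)

lemma H_carrier [simp]: "h \<in> H \<Longrightarrow> h \<in> carrier R"
  using H_Units Units_closed by blast

lemma H_mult [simp]: "g \<in> H \<Longrightarrow> h \<in> H \<Longrightarrow> g \<otimes> h \<in> H"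
  using subgroup.m_closed[OF subgroup_H] by (simp add: units_of_mult)

lemma H_one [simp]: "\<one> \<in> H"
  using subgroup.one_closed[OF subgroup_H] by (simp add: units_of_one)

lemma H_inv [simp]: "h \<in> H \<Longrightarrow> inv h \<in> H"
  using subgroup.m_inv_closed[OF subgroup_H] H_Units by (auto simp: units_of_inv)

lemma H_inv_mult [simp]:
  assumes "h \<in> H" shows "h \<otimes> inv h = \<one>" "inv h \<otimes> h = \<one>"
  using assms H_Units by auto

lemma finite_H: "finite H"
  by (rule finite_subset[OF _ finite_carrier]) auto

lemma Units_mult_eq_zero:
  assumes "u \<in> Units R" "x \<in> carrier R" "x \<otimes> u = \<zero>"
  shows "x = \<zero>"
proof -
  have "(x \<otimes> u) \<otimes> inv u = x"
    using assms(1,2) by (simp add: m_assoc)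
  then show ?thesis
    using assms by simp
qed

lemma fixed_imp_zero:
  assumes "s \<in> H" "s \<noteq> \<one>" "x \<in> carrier R" "x \<otimes> s = x"
  shows "x = \<zero>"
proof -
  have "x \<otimes> (\<one> \<ominus> s) = \<zero>"
    using assms by (simp add: minus_eq r_distr r_minus r_neg)
  then show ?thesis
    using Units_mult_eq_zero[OF diff_unit] assms by blast
qed

text \<open>If \<open>x g = x h\<close>, then \<open>x\<close> is fixed by \<open>g\<close> times
  the inverse of \<open>h\<close>. So \<open>H\<close> acts freely on the nonzero elements, and
  their orbits all have the size of \<open>H\<close>.\<close>

lemma mult_H_inject:
  assumes "x \<in> carrier R" "x \<noteq> \<zero>" "g \<in> H" "h \<in> H" "x \<otimes> g = x \<otimes> h"
  shows "g = h"
proof (rule ccontr)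
  assume "g \<noteq> h"
  have *: "x \<otimes> (g \<otimes> inv h) = x"
    using assms by (simp flip: m_assoc) (simp add: m_assoc)
  have "g \<otimes> inv h \<noteq> \<one>"
  proof
    assume "g \<otimes> inv h = \<one>"
    then have "g \<otimes> inv h \<otimes> h = h"
      using assms by simp
    then show False
      using assms \<open>g \<noteq> h\<close> by (simp add: m_assoc)
  qed
  then show False
    using fixed_imp_zero[of "g \<otimes> inv h" x] * assms by simp
qed

lemma orbit_eq: "x <# H = (\<lambda>h. x \<otimes> h) ` H"
  by (auto simp: l_coset_def)

lemma orbit_self: "x \<in> carrier R \<Longrightarrow> x \<in> x <# H"
  unfolding orbit_eq by (rule image_eqI[of _ _ \<one>]) auto

lemma orbit_mult:
  assumes "x \<in> carrier R" "h \<in> H"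
  shows "(x \<otimes> h) <# H = x <# H"
proof (rule Set.set_eqI)
  have "x \<otimes> g = x \<otimes> h \<otimes> (inv h \<otimes> g)" if "g \<in> H" for g
  proof -
    have "h \<otimes> (inv h \<otimes> g) = g"
      using assms that by (simp flip: m_assoc)
    then show ?thesis
      using assms that by (simp add: m_assoc)
  qed
  then show "y \<in> (x \<otimes> h) <# H \<longleftrightarrow> y \<in> x <# H" for y
    unfolding orbit_eq image_iff using assms H_inv[of h] H_mult
    by (metis H_carrier m_assoc)
qed

lemma orbit_eqI:
  assumes "x \<in> carrier R" "y \<in> x <# H"
  shows "y <# H = x <# H"
proof -
  obtain h where "h \<in> H" "y = x \<otimes> h"
    using assms(2) by (auto simp: orbit_eq)
  then show ?thesis
    using orbit_mult[OF assms(1)] by simp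
qed

lemma orbit_nonzero:
  assumes "x \<in> carrier R" "x \<noteq> \<zero>" "y \<in> x <# H"
  shows "y \<in> carrier R" "y \<noteq> \<zero>"
proof -
  obtain h where h: "h \<in> H" "y = x \<otimes> h"
    using assms(3) by (auto simp: orbit_eq)
  show "y \<in> carrier R"
    using h assms(1) by simp
  show "y \<noteq> \<zero>"
    using Units_mult_eq_zero[OF H_Units[OF h(1)] assms(1)] h(2) assms(2) by auto
qed

lemma orbitsE:
  assumes "D \<in> orbits"
  obtains x where "x \<in> carrier R" "x \<noteq> \<zero>" "D = x <# H"
  using assms unfolding orbits_def by blast

lemma card_orbit:
  assumes "x \<in> carrier R" "x \<noteq> \<zero>"
  shows "card (x <# H) = card H"
  unfolding orbit_eq using mult_H_inject[OF assms] by (intro card_image inj_onI)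

lemma disjoint_orbits:
  assumes "D \<in> orbits" "D' \<in> orbits" "D \<inter> D' \<noteq> {}"
  shows "D = D'"
proof -
  obtain x y z where "x \<in> carrier R" "D = x <# H" "y \<in> carrier R" "D' = y <# H"
    and "z \<in> D" "z \<in> D'"
    using assms by (auto simp: orbits_def)
  then show ?thesis
    using orbit_eqI[of x z] orbit_eqI[of y z] by simp
qed

section \<open>Orbits as a difference family\<close>

text \<open>Two elements of one orbit are \<open>a\<close> and \<open>a s\<close> with
  \<open>s\<close> in \<open>H\<close>, and their difference is \<open>a (1 - s)\<close>. For each
  \<open>s\<close> other than one there is exactly one \<open>a\<close> making this equal to
  \<open>g\<close>, namely \<open>d s\<close>.\<close>

lemma card_difference_pairs:
  assumes g: "g \<in> carrier R" "g \<noteq> \<zero>"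
  shows "card {(a, a'). (\<exists>D\<in>orbits. a \<in> D \<and> a' \<in> D) \<and> a \<noteq> a' \<and> a \<ominus> a' = g} = card H - 1"
proof -
  define d where "d s = g \<otimes> inv (\<one> \<ominus> s)" for s
  have d: "d s \<in> carrier R" "d s \<noteq> \<zero>" "d s \<otimes> (\<one> \<ominus> s) = g" if "s \<in> H" "s \<noteq> \<one>" for s
  proof -
    have u: "\<one> \<ominus> s \<in> Units R" using that by (rule diff_unit)
    then have v: "inv (\<one> \<ominus> s) \<in> carrier R" by (rule Units_inv_closed)
    show 1: "d s \<in> carrier R"
      unfolding d_def using g v by simp
    show 2: "d s \<otimes> (\<one> \<ominus> s) = g"
      unfolding d_def using u v g(1) by (simp only: m_assoc Units_closed Units_l_inv r_one)
    show "d s \<noteq> \<zero>"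
    proof
      assume "d s = \<zero>"
      then show False using 2 g(2) l_null[OF Units_closed[OF u]] by simp
    qed
  qed
  have d': "d s \<ominus> d s \<otimes> s = g" if "s \<in> H" "s \<noteq> \<one>" for s
    using d[OF that] that by (simp add: minus_eq r_distr r_minus)
  have "{(a, a'). (\<exists>D\<in>orbits. a \<in> D \<and> a' \<in> D) \<and> a \<noteq> a' \<and> a \<ominus> a' = g}
    = (\<lambda>s. (d s, d s \<otimes> s)) ` (H - {\<one>})"
  proof (intro equalityI subsetI)
    fix z assume "z \<in> {(a, a'). (\<exists>D\<in>orbits. a \<in> D \<and> a' \<in> D) \<and> a \<noteq> a' \<and> a \<ominus> a' = g}"
    then obtain a a' D where z: "z = (a, a')" "a \<noteq> a'" "a \<ominus> a' = g" and
      D: "D \<in> orbits" "a \<in> D" "a' \<in> D"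
      by auto
    then obtain x where "x \<in> carrier R" "x \<noteq> \<zero>" "D = x <# H"
      by (auto elim: orbitsE)
    then have a: "a \<in> carrier R" "a' \<in> a <# H"
      using D orbit_nonzero(1)[of x a] orbit_eqI[of x a] by auto
    then obtain s where s: "s \<in> H" "a' = a \<otimes> s"
      by (auto simp: orbit_eq)
    have s1: "s \<noteq> \<one>" using s z a by auto
    have "a \<otimes> (\<one> \<ominus> s) = g"
      using z(3) a s by (simp add: minus_eq r_distr r_minus)
    then have "a = d s"
      using diff_unit[OF s(1) s1] a by (auto simp: d_def m_assoc)
    then show "z \<in> (\<lambda>s. (d s, d s \<otimes> s)) ` (H - {\<one>})"
      using s s1 z by auto
  next
    fix z assume "z \<in> (\<lambda>s. (d s, d s \<otimes> s)) ` (H - {\<one>})"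
    then obtain s where s: "s \<in> H" "s \<noteq> \<one>" "z = (d s, d s \<otimes> s)" by auto
    have "d s \<noteq> d s \<otimes> s"
      using fixed_imp_zero[OF s(1,2), of "d s"] d[OF s(1,2)] by auto
    moreover have "d s <# H \<in> orbits" "d s \<in> d s <# H" "d s \<otimes> s \<in> d s <# H"
      using d[OF s(1,2)] orbit_self s by (auto simp: orbits_def) (auto simp: orbit_eq)
    ultimately show "z \<in> {(a, a'). (\<exists>D\<in>orbits. a \<in> D \<and> a' \<in> D) \<and> a \<noteq> a' \<and> a \<ominus> a' = g}"
      using d'[OF s(1,2)] s(3) by auto
  qed
  moreover have "inj_on (\<lambda>s. (d s, d s \<otimes> s)) (H - {\<one>})"
  proof (rule inj_onI)
    fix s t assume st: "s \<in> H - {\<one>}" "t \<in> H - {\<one>}" "(d s, d s \<otimes> s) = (d t, d t \<otimes> t)"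
    then show "s = t"
      using mult_H_inject[of "d s" s t] d[of s] by auto
  qed
  ultimately show ?thesis
    using finite_H by (simp add: card_image)
qed

text \<open>Distinct orbits are disjoint, so the multiplicities of \<open>g\<close> in the single
  orbits add up to the number of all pairs in a common orbit with difference
  \<open>g\<close>.\<close>

theorem disjoint_difference_family_orbits:
  "disjoint_difference_family R (card (carrier R)) (card H) (card H - 1) orbits"
proof -
  have sub: "D \<subseteq> carrier R" "card D = card H" if "D \<in> orbits" for D
  proof -
    obtain x where "x \<in> carrier R" "x \<noteq> \<zero>" "D = x <# H"
      using \<open>D \<in> orbits\<close> by (rule orbitsE)
    then show "D \<subseteq> carrier R" "card D = card H"
      using orbit_nonzero(1) card_orbit by auto
  qed
  have fin: "finite orbits"
    using finite_carrier by (simp add: orbits_def)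
  have "count (\<Sum>D\<in>orbits. difference_multiset R D) g = card H - 1"
    if g: "g \<in> carrier R" "g \<noteq> \<zero>" for g
  proof -
    define T where "T D = {z \<in> {(a, a'). a \<in> D \<and> a' \<in> D \<and> a \<noteq> a'}.
      (case z of (a, a') \<Rightarrow> a \<ominus> a') = g}" for D
    have finp: "finite {(a, a'). a \<in> D \<and> a' \<in> D \<and> a \<noteq> a'}" if "D \<in> orbits" for D
    proof -
      have "finite (D \<times> D)" using sub[OF that] finite_carrier finite_subset by blast
      then show ?thesis by (rule finite_subset[rotated]) auto
    qed
    have "count (\<Sum>D\<in>orbits. difference_multiset R D) g = (\<Sum>D\<in>orbits. card (T D))"
      unfolding count_sum difference_multiset_def T_def
      using finp by (intro sum.cong refl) (simp add: count_image_mset_eq_card_vimage)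
    also have "\<dots> = card (\<Union>D\<in>orbits. T D)"
    proof (rule card_UN_disjoint[symmetric])
      show "\<forall>D\<in>orbits. finite (T D)"
        using finp by (auto simp: T_def)
      show "\<forall>D\<in>orbits. \<forall>D'\<in>orbits. D \<noteq> D' \<longrightarrow> T D \<inter> T D' = {}"
        using disjoint_orbits unfolding T_def by blast
    qed (rule fin)
    also have "(\<Union>D\<in>orbits. T D) =
        {(a, a'). (\<exists>D\<in>orbits. a \<in> D \<and> a' \<in> D) \<and> a \<noteq> a' \<and> a \<ominus> a' = g}"
      by (auto simp: T_def)
    finally show ?thesis
      using card_difference_pairs[OF g] by simp
  qed
  then show ?thesis
    unfolding disjoint_difference_family_def
    using abelian_group_axioms finite_carrier sub disjoint_orbits by blast
qed

text \<open>For \<open>a\<close> in \<open>H\<close> the difference is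
  \<open>a (1 - inv a b)\<close>, a product of two units. Consequently distinct elements of
  \<open>{0} \<union> H\<close> are never congruent modulo a proper ideal.\<close>

lemma minus_Units:
  assumes "a \<in> insert \<zero> H" "b \<in> insert \<zero> H" "a \<noteq> b"
  shows "a \<ominus> b \<in> Units R"
proof (cases "a = \<zero>")
  case True
  then have "b \<in> Units R"
    using assms H_Units by auto
  moreover have "\<ominus> \<one> \<in> Units R"
  proof (rule unit_factor[of "\<ominus> \<one>" "\<ominus> \<one>"])
    show "\<ominus> \<one> \<otimes> \<ominus> \<one> \<in> Units R"
      by (simp add: l_minus r_minus)
  qed simp_all
  ultimately have "\<ominus> \<one> \<otimes> b \<in> Units R"
    by (intro Units_m_closed)
  moreover have "\<zero> \<ominus> b = \<ominus> \<one> \<otimes> b"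
    using Units_closed[OF \<open>b \<in> Units R\<close>] by (simp add: minus_eq l_minus)
  ultimately show ?thesis
    unfolding \<open>a = \<zero>\<close> by simp
next
  case False
  then have a: "a \<in> H" using assms by blast
  have bc: "b \<in> carrier R" using assms(2) by auto
  have "\<one> \<ominus> inv a \<otimes> b \<in> Units R"
  proof (cases "b = \<zero>")
    case True
    then show ?thesis using a by (simp add: minus_eq)
  next
    case False
    then have "b \<in> H" using assms by blast
    moreover have "inv a \<otimes> b \<noteq> \<one>"
    proof
      assume "inv a \<otimes> b = \<one>"
      then have "a \<otimes> (inv a \<otimes> b) = a" using a by simp
      moreover have "a \<otimes> (inv a \<otimes> b) = (a \<otimes> inv a) \<otimes> b"
        using a bc by (intro m_assoc[symmetric]) auto
      ultimately show False using a bc assms(3) by simp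
    qed
    ultimately show ?thesis using a by (intro diff_unit) auto
  qed
  then have "a \<otimes> (\<one> \<ominus> inv a \<otimes> b) \<in> Units R"
    using H_Units[OF a] by (rule Units_m_closed[rotated])
  also have "a \<otimes> (\<one> \<ominus> inv a \<otimes> b) = a \<ominus> (a \<otimes> inv a) \<otimes> b"
    using H_carrier[OF a] H_carrier[OF H_inv[OF a]] bc by algebra
  also have "\<dots> = a \<ominus> b"
    using a bc by simp
  finally show ?thesis .
qed

text \<open>Adding one amounts to subtracting \<open>0 - 1\<close>, so all multiples of one are
  reached from zero. The multiple of interest is \<open>p\<close>.\<close>

lemma closed_imp_add_pow_mem:
  assumes closed: "\<And>a b. a \<in> insert \<zero> H \<Longrightarrow> b \<in> insert \<zero> H \<Longrightarrow> a \<ominus> b \<in> insert \<zero> H"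
  shows "add_pow R (n::nat) \<one> \<in> insert \<zero> H"
proof (induction n)
  case (Suc n)
  have "\<zero> \<ominus> \<one> \<in> insert \<zero> H"
    by (intro closed) auto
  with Suc have "add_pow R n \<one> \<ominus> (\<zero> \<ominus> \<one>) \<in> insert \<zero> H"
    by (rule closed)
  moreover have "add_pow R n \<one> \<ominus> (\<zero> \<ominus> \<one>) = add_pow R (Suc n) \<one>"
    by (simp add: minus_eq)
  ultimately show ?case by simp
qed simp

section \<open>Blocks of the development and their completing points\<close>

text \<open>The translate by \<open>g\<close> of the orbit of \<open>u\<close>. The parameter
  \<open>g\<close> is kept visible because it is the candidate for the completing point.\<close>

definition block :: "'a \<Rightarrow> 'a \<Rightarrow> 'a set" where
  "block u g = (\<lambda>h. u \<otimes> h \<oplus> g) ` H"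

lemma dev_orbits_blocks:
  "b \<in># snd (dev R orbits) \<longleftrightarrow>
    (\<exists>u g. u \<in> carrier R \<and> u \<noteq> \<zero> \<and> g \<in> carrier R \<and> b = block u g)"
proof -
  have fin: "finite (orbits \<times> carrier R)"
    using finite_carrier by (simp add: orbits_def)
  have "(u <# H) +>\<^bsub>R\<^esub> g = block u g" for u g
    by (auto simp: a_r_coset_def' orbit_eq block_def)
  moreover have "b \<in># snd (dev R orbits) \<longleftrightarrow> (\<exists>D\<in>orbits. \<exists>g\<in>carrier R. b = D +>\<^bsub>R\<^esub> g)"
    using fin by (auto simp: dev_def)
  ultimately show ?thesis
    unfolding orbits_def by (simp add: Bex_def conj_assoc)
qed

lemma in_dev_orbitsE:
  assumes "b \<in># snd (dev R orbits)"
  obtains u g where "u \<in> carrier R" "u \<noteq> \<zero>" "g \<in> carrier R" "b = block u g"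
  using assms unfolding dev_orbits_blocks by (elim exE conjE)

lemma block_in_dev_orbits:
  "u \<in> carrier R \<Longrightarrow> u \<noteq> \<zero> \<Longrightarrow> g \<in> carrier R \<Longrightarrow> block u g \<in># snd (dev R orbits)"
  unfolding dev_orbits_blocks by (intro exI conjI) (assumption | rule refl)+

lemma dev_orbits_points [simp]: "fst (dev R orbits) = carrier R"
  by (simp add: dev_def)

lemma block_subset: "u \<in> carrier R \<Longrightarrow> g \<in> carrier R \<Longrightarrow> block u g \<subseteq> carrier R"
  by (auto simp: block_def)

lemma dev_orbits_subset:
  assumes "b \<in># snd (dev R orbits)"
  shows "b \<subseteq> fst (dev R orbits)"
  using assms by (rule in_dev_orbitsE) (simp add: block_subset)

lemma nonzero_mult_H: "u \<in> carrier R \<Longrightarrow> u \<noteq> \<zero> \<Longrightarrow> h \<in> H \<Longrightarrow> u \<otimes> h \<noteq> \<zero>"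
  using Units_mult_eq_zero[OF H_Units] by blast

lemma base_notin_block:
  assumes "u \<in> carrier R" "u \<noteq> \<zero>" "g \<in> carrier R"
  shows "g \<notin> block u g"
proof
  assume "g \<in> block u g"
  then obtain h where h: "h \<in> H" "g = u \<otimes> h \<oplus> g"
    by (auto simp: block_def)
  then have "u \<otimes> h = \<zero>"
    using add.r_cancel[of "u \<otimes> h" g \<zero>] assms by simp
  then show False
    using nonzero_mult_H[OF assms(1,2) h(1)] by contradiction
qed

lemma insert_base_block:
  assumes "u \<in> carrier R" "g \<in> carrier R"
  shows "insert g (block u g) = (\<lambda>k. u \<otimes> k \<oplus> g) ` insert \<zero> H"
  using assms by (simp add: block_def)

text \<open>Now \<open>K = {0} \<union> H\<close> is a subfield, and the block together with
  \<open>g\<close> is the line \<open>u K + g\<close>. Removing a point \<open>y\<close> of the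
  block leaves \<open>u H + y\<close>, so \<open>g\<close> completes it. A block arising from
  another completion would share two points with this line and therefore lie in it.\<close>

lemma uniquely_completable_if_closed:
  assumes closed: "\<And>a b. a \<in> insert \<zero> H \<Longrightarrow> b \<in> insert \<zero> H \<Longrightarrow> a \<ominus> b \<in> insert \<zero> H"
    and card: "card H \<ge> 3"
  shows "uniquely_completable (dev R orbits)"
  unfolding uniquely_completable_def
proof
  fix B assume "B \<in># snd (dev R orbits)"
  then obtain u g where u: "u \<in> carrier R" "u \<noteq> \<zero>" and g: "g \<in> carrier R" and B: "B = block u g"
    by (rule in_dev_orbitsE)
  have K_carrier: "k \<in> carrier R" if "k \<in> insert \<zero> H" for k
    using that by auto
  have closed_add: "a \<oplus> b \<in> insert \<zero> H" if "a \<in> insert \<zero> H" "b \<in> insert \<zero> H" for a b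
  proof -
    have "a \<ominus> (\<zero> \<ominus> b) \<in> insert \<zero> H"
      using closed that by blast
    then show ?thesis
      using K_carrier[OF that(1)] K_carrier[OF that(2)] by (simp add: minus_eq)
  qed
  have diff_H: "a \<ominus> b \<in> H" if "a \<in> insert \<zero> H" "b \<in> insert \<zero> H" "a \<noteq> b" for a b
    using closed[OF that(1,2)] that K_carrier[OF that(1)] K_carrier[OF that(2)] by auto
  have "insert g B - {y} = block u y" if y: "y \<in> B" for y
  proof -
    obtain h where h: "h \<in> H" "y = u \<otimes> h \<oplus> g"
      using y by (auto simp: B block_def)
    show ?thesis
    proof (intro equalityI subsetI)
      fix z assume "z \<in> insert g B - {y}"
      then obtain k where k: "k \<in> insert \<zero> H" "z = u \<otimes> k \<oplus> g" "z \<noteq> y"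
        unfolding B insert_base_block[OF u(1) g] by blast
      then have l: "k \<ominus> h \<in> H"
        using h by (intro diff_H) auto
      have "u \<otimes> (k \<ominus> h) \<oplus> (u \<otimes> h \<oplus> g) = u \<otimes> k \<oplus> g"
        using u(1) g K_carrier[OF k(1)] H_carrier[OF h(1)] by algebra
      then show "z \<in> block u y"
        unfolding block_def using l h k by (metis image_eqI)
    next
      fix z assume "z \<in> block u y"
      then obtain l where l: "l \<in> H" "z = u \<otimes> l \<oplus> y"
        by (auto simp: block_def)
      then have "z = u \<otimes> (l \<oplus> h) \<oplus> g"
        using u(1) g h by (simp add: r_distr a_assoc)
      moreover have "l \<oplus> h \<in> insert \<zero> H"
        using l h by (intro closed_add) auto
      ultimately have "z \<in> insert g B"
        unfolding B insert_base_block[OF u(1) g] by blast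
      moreover have "z \<noteq> y"
        using base_notin_block[of u y] u g h \<open>z \<in> block u y\<close> by auto
      ultimately show "z \<in> insert g B - {y}" by simp
    qed
  qed
  moreover have "block u y \<in># snd (dev R orbits)" if "y \<in> B" for y
    using that block_subset[OF u(1) g] B by (intro block_in_dev_orbits u) auto
  ultimately have ex: "completion (dev R orbits) B g"
    using g base_notin_block[OF u g] B by (simp add: completion_def)
  have "x = g" if x: "completion (dev R orbits) B x" for x
  proof -
    \<comment> \<open>Any point of \<open>B\<close> would do; this one is the point with parameter
      \<open>h = 1\<close>.\<close>
    define y where "y = u \<otimes> \<one> \<oplus> g"
    have "y \<in> B" by (auto simp: y_def B block_def)
    then have "insert x B - {y} \<in># snd (dev R orbits)"
      using x by (simp add: completion_def)
    then obtain v g' where v: "v \<in> carrier R" "v \<noteq> \<zero>" and g': "g' \<in> carrier R"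
      and B': "insert x B - {y} = block v g'"
      by (rule in_dev_orbitsE)
    \<comment> \<open>Two points of \<open>B\<close> besides \<open>y\<close> are required to
      determine the line; this is where \<open>H\<close> must have three elements.\<close>
    have "\<not> card (H - {\<one>}) \<le> Suc 0"
      using card finite_H by simp
    then have "\<not> (\<forall>a\<in>H - {\<one>}. \<forall>b\<in>H - {\<one>}. a = b)"
      using card_le_Suc0_iff_eq[of "H - {\<one>}"] finite_H by blast
    then obtain h1 h2 where h: "h1 \<in> H" "h2 \<in> H" "h1 \<noteq> \<one>" "h2 \<noteq> \<one>" "h1 \<noteq> h2"
      by auto
    have in_block: "u \<otimes> h' \<oplus> g \<in> block v g'" if "h' \<in> H" "h' \<noteq> \<one>" for h'
    proof -
      have "u \<otimes> h' \<noteq> u \<otimes> \<one>"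
        using mult_H_inject[OF u that(1) H_one] that(2) by blast
      then have "u \<otimes> h' \<oplus> g \<noteq> y"
        using u g that unfolding y_def by simp
      then have "u \<otimes> h' \<oplus> g \<in> insert x B - {y}"
        using that(1) unfolding B block_def by blast
      then show ?thesis
        using B' by simp
    qed
    obtain k1 where k1: "k1 \<in> H" "u \<otimes> h1 \<oplus> g = v \<otimes> k1 \<oplus> g'"
      using in_block h by (auto simp: block_def)
    obtain k2 where k2: "k2 \<in> H" "u \<otimes> h2 \<oplus> g = v \<otimes> k2 \<oplus> g'"
      using in_block h by (auto simp: block_def)
    note carr [simp] = u(1) v(1) g g' and H = H_carrier[OF h(1)] H_carrier[OF h(2)]
      H_carrier[OF k1(1)] H_carrier[OF k2(1)]
    have "k1 \<noteq> k2"
    proof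
      assume "k1 = k2"
      then have "u \<otimes> h1 = u \<otimes> h2"
        using k1 k2 H by (metis add.r_cancel carr m_closed)
      then show False
        using mult_H_inject[OF u] h by blast
    qed
    then have e: "k1 \<ominus> k2 \<in> H"
      using k1 k2 by (intro diff_H) auto
    have d: "h1 \<ominus> h2 \<in> H"
      using h by (intro diff_H) auto
    \<comment> \<open>\<open>m\<close> is the quotient of the parameter differences of the two
      shared points in the two blocks. Both differences lie in \<open>H\<close>, hence so does
      \<open>m\<close>, and \<open>v = u m\<close>: the blocks have the same direction.\<close>
    define m where "m = (h1 \<ominus> h2) \<otimes> inv (k1 \<ominus> k2)"
    have m: "m \<in> H" using d e by (simp add: m_def)
    have "u \<otimes> (h1 \<ominus> h2) = (u \<otimes> h1 \<oplus> g) \<ominus> (u \<otimes> h2 \<oplus> g)"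
      using carr H by algebra
    also have "\<dots> = v \<otimes> (k1 \<ominus> k2)"
      unfolding k1 k2 using carr H by algebra
    finally have uv: "u \<otimes> (h1 \<ominus> h2) = v \<otimes> (k1 \<ominus> k2)" .
    have "u \<otimes> m = v \<otimes> (k1 \<ominus> k2) \<otimes> inv (k1 \<ominus> k2)"
      using d e uv[symmetric] unfolding m_def by (simp add: m_assoc)
    also have "\<dots> = v"
      using e by (simp add: m_assoc)
    finally have vm: "v = u \<otimes> m" by simp
    have "x \<noteq> y" "x \<notin> B"
      using \<open>y \<in> B\<close> x by (auto simp: completion_def)
    then have "x \<in> block v g'"
      using B' by blast
    then obtain k where k: "k \<in> H" "x = v \<otimes> k \<oplus> g'"
      by (auto simp: block_def)
    \<comment> \<open>Eliminating \<open>g'\<close> by means of the first shared point puts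
      \<open>x\<close> on the line \<open>u K + g\<close>. As \<open>x\<close> is not in
      \<open>B\<close>, it can only be \<open>g\<close>.\<close>
    have "g' = (v \<otimes> k1 \<oplus> g') \<ominus> v \<otimes> k1"
      using carr H by algebra
    also have "\<dots> = u \<otimes> h1 \<oplus> g \<ominus> u \<otimes> m \<otimes> k1"
      by (simp only: k1(2) flip: vm)
    finally have "x = u \<otimes> m \<otimes> k \<oplus> (u \<otimes> h1 \<oplus> g \<ominus> u \<otimes> m \<otimes> k1)"
      using k(2) vm by simp
    also have "\<dots> = u \<otimes> ((m \<otimes> k \<ominus> m \<otimes> k1) \<oplus> h1) \<oplus> g"
      using carr(1,3) H H_carrier[OF m] H_carrier[OF k(1)] by algebra
    finally have "x = u \<otimes> ((m \<otimes> k \<ominus> m \<otimes> k1) \<oplus> h1) \<oplus> g" .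
    moreover have "(m \<otimes> k \<ominus> m \<otimes> k1) \<oplus> h1 \<in> insert \<zero> H"
      using m k k1 h by (intro closed_add closed) auto
    ultimately have "x \<in> insert g B"
      unfolding B insert_base_block[OF u(1) g] by blast
    then show ?thesis
      using \<open>x \<notin> B\<close> by simp
  qed
  then show "\<exists>!x. completion (dev R orbits) B x"
    using ex by blast
qed

text \<open>The homothety with ratio \<open>t\<close> and centre \<open>g\<close> maps blocks to
  blocks and preserves \<open>block u g\<close>. It therefore fixes the unique completing point
  \<open>x\<close>; then \<open>x - g\<close> is fixed by \<open>t\<close> and must vanish.\<close>

lemma completion_unique_imp_base:
  assumes t: "t \<in> H" "t \<noteq> \<one>"
    and u: "u \<in> carrier R" "u \<noteq> \<zero>" and g: "g \<in> carrier R"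
    and x: "completion (dev R orbits) (block u g) x"
    and unique: "\<And>y. completion (dev R orbits) (block u g) y \<Longrightarrow> y = x"
  shows "x = g"
proof -
  \<comment> \<open>This is \<open>g + t (z - g)\<close> multiplied out.\<close>
  define \<phi> where "\<phi> z = t \<otimes> z \<oplus> (g \<ominus> t \<otimes> g)" for z
  have xc: "x \<in> carrier R" using x by (simp add: completion_def)
  have tc: "t \<in> carrier R" using t by simp
  have inj: "inj_on \<phi> (carrier R)"
  proof (rule inj_onI)
    fix y z assume yz: "y \<in> carrier R" "z \<in> carrier R" "\<phi> y = \<phi> z"
    then have "t \<otimes> y = t \<otimes> z"
      using tc g by (simp add: \<phi>_def)
    then show "y = z"
      using H_Units[OF t(1)] yz by simp
  qed
  have \<phi>_block: "\<phi> ` block v a = block (t \<otimes> v) (\<phi> a)" if "v \<in> carrier R" "a \<in> carrier R" for v a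
  proof -
    have "\<phi> (v \<otimes> h \<oplus> a) = t \<otimes> v \<otimes> h \<oplus> \<phi> a" if "h \<in> H" for h
      unfolding \<phi>_def using \<open>v \<in> carrier R\<close> \<open>a \<in> carrier R\<close> tc g H_carrier[OF that] by algebra
    then show ?thesis
      by (simp add: block_def image_image)
  qed
  have \<phi>_dev: "\<phi> ` b \<in># snd (dev R orbits)" if b: "b \<in># snd (dev R orbits)" for b
  proof -
    obtain v a where v: "v \<in> carrier R" "v \<noteq> \<zero>" "a \<in> carrier R" "b = block v a"
      using b by (rule in_dev_orbitsE)
    have "t \<otimes> v \<noteq> \<zero>"
      using nonzero_mult_H[OF v(1,2) t(1)] v tc by (simp add: m_comm)
    then show ?thesis
      using \<phi>_block[OF v(1,3)] v tc g block_in_dev_orbits[of "t \<otimes> v" "\<phi> a"]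
      by (simp add: \<phi>_def)
  qed
  have \<phi>g: "\<phi> g = g"
    unfolding \<phi>_def using tc g by algebra
  have "\<phi> ` block u g = block u g"
  proof -
    have "(u \<otimes> t) <# H = u <# H"
      using orbit_mult[OF u(1) t(1)] .
    then have "(\<lambda>z. z \<oplus> g) ` ((u \<otimes> t) <# H) = (\<lambda>z. z \<oplus> g) ` (u <# H)"
      by simp
    then have "block (u \<otimes> t) g = block u g"
      by (simp add: orbit_eq block_def image_image)
    then show ?thesis
      using \<phi>_block[OF u(1) g] \<phi>g u tc by (simp add: m_comm)
  qed
  then have "completion (dev R orbits) (block u g) (\<phi> x)"
    using completion_image[of \<phi> "dev R orbits" "dev R orbits" "block u g" x] inj \<phi>_dev x
      block_subset[OF u(1) g] tc g by (auto simp: \<phi>_def)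
  then have "\<phi> x = x"
    by (rule unique)
  moreover have "(x \<ominus> g) \<otimes> t = \<phi> x \<ominus> g"
    unfolding \<phi>_def using tc xc g by algebra
  ultimately have "(x \<ominus> g) \<otimes> t = x \<ominus> g" by simp
  then have "x \<ominus> g = \<zero>"
    using fixed_imp_zero[OF t] xc g by simp
  then show ?thesis
    using xc g by simp
qed

text \<open>Since \<open>H\<close> is completed by \<open>0\<close>, the set \<open>B\<close>, which
  is \<open>{0} \<union> H\<close> without \<open>1\<close>, is a block, and it is completed by
  \<open>1\<close>. So \<open>B\<close> is an orbit translated by \<open>1\<close>, and
  \<open>0\<close> lying in \<open>B\<close> identifies it as \<open>1 - H\<close>. Closure under
  subtraction then follows from \<open>x - y = x (1 - inv x y)\<close>.\<close>

lemma closed_if_uniquely_completable: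
  assumes comp: "uniquely_completable (dev R orbits)"
    and t: "t \<in> H" "t \<noteq> \<one>"
    and a: "a \<in> insert \<zero> H" and b: "b \<in> insert \<zero> H"
  shows "a \<ominus> b \<in> insert \<zero> H"
proof -
  have base: "completion (dev R orbits) (block u g) x \<longleftrightarrow> x = g"
    if "u \<in> carrier R" "u \<noteq> \<zero>" "g \<in> carrier R" for u g x
  proof -
    have "block u g \<in># snd (dev R orbits)"
      using that by (rule block_in_dev_orbits)
    then obtain y where y: "completion (dev R orbits) (block u g) y"
      "\<And>z. completion (dev R orbits) (block u g) z \<Longrightarrow> z = y"
      using comp unfolding uniquely_completable_def by metis
    then have "y = g"
      using completion_unique_imp_base[OF t that] by blast
    then show ?thesis using y by blast
  qed
  have nontrivial: "\<one> \<noteq> \<zero>"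
  proof
    assume "\<one> = \<zero>"
    then have "carrier R = {\<zero>}" by (rule one_zeroD)
    then show False using t H_carrier[OF t(1)] \<open>\<one> = \<zero>\<close> by auto
  qed
  have zero_notin: "\<zero> \<notin> H"
    using nonzero_mult_H[OF one_closed nontrivial] by force
  have H: "block \<one> \<zero> = H"
    by (simp add: block_def)
  have H_block: "H \<in># snd (dev R orbits)"
    using block_in_dev_orbits[OF one_closed nontrivial zero_closed] by (simp only: H)
  have "completion (dev R orbits) H \<zero>"
    using base[OF one_closed nontrivial zero_closed] by (simp only: H)
  then have punctured: "insert \<zero> H - {y} \<in># snd (dev R orbits)" if "y \<in> H" for y
    using that by (simp add: completion_def)
  define B where "B = insert \<zero> H - {\<one>}"
  have "B \<in># snd (dev R orbits)"
    using punctured[of \<one>] by (simp add: B_def)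
  then obtain u g where u: "u \<in> carrier R" "u \<noteq> \<zero>" "g \<in> carrier R" "B = block u g"
    by (rule in_dev_orbitsE)
  \<comment> \<open>Putting \<open>1\<close> back gives \<open>{0} \<union> H\<close>. Removing
    \<open>0\<close> from it leaves the block \<open>H\<close>, and removing an element of
    \<open>H\<close> leaves a block because \<open>0\<close> completes \<open>H\<close>.\<close>
  have "insert \<one> B - {y} \<in># snd (dev R orbits)" if "y \<in> B" for y
  proof -
    have "insert \<one> B = insert \<zero> H"
      by (auto simp: B_def)
    then show ?thesis
      using that punctured[of y] H_block zero_notin by (cases "y = \<zero>") (auto simp: B_def)
  qed
  then have "completion (dev R orbits) B \<one>"
    by (simp add: completion_def B_def)
  then have g: "g = \<one>"
    using base[OF u(1-3)] u(4) by simp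
  have "\<zero> \<in> B"
    unfolding B_def using nontrivial by simp
  then have "\<zero> \<in> block u \<one>"
    by (simp only: u(4) g)
  then obtain h where h: "h \<in> H" "\<zero> = u \<otimes> h \<oplus> \<one>"
    by (auto simp: block_def)
  \<comment> \<open>Hence the orbit of \<open>u\<close> is the orbit of \<open>-1\<close>, and
    \<open>B\<close> consists of the elements \<open>1 - s\<close> with \<open>s\<close> in
    \<open>H\<close>.\<close>
  then have uh: "u \<otimes> h = \<ominus> \<one>"
    using u(1) by (metis H_carrier m_closed minus_equality one_closed)
  have one_minus: "\<one> \<ominus> s \<in> insert \<zero> H" if "s \<in> H" for s
  proof -
    have "u \<otimes> (h \<otimes> s) \<oplus> \<one> \<in> block u \<one>"
      using h that by (auto simp: block_def)
    moreover have "u \<otimes> (h \<otimes> s) \<oplus> \<one> = \<one> \<ominus> s"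
      using u(1) h(1) that uh by (simp flip: m_assoc) (simp add: l_minus minus_eq a_comm)
    ultimately have "\<one> \<ominus> s \<in> B"
      by (simp only: u(4) g)
    then show ?thesis
      unfolding B_def by simp
  qed
  have K_mult: "x \<otimes> y \<in> insert \<zero> H" if "x \<in> H" "y \<in> insert \<zero> H" for x y
    using that by auto
  have sub_H: "x \<ominus> y \<in> insert \<zero> H" if "x \<in> H" "y \<in> H" for x y
  proof -
    have "x \<ominus> y = x \<otimes> (\<one> \<ominus> inv x \<otimes> y)"
      using that by (simp add: minus_eq r_distr r_minus flip: m_assoc)
    then show ?thesis
      using K_mult[OF that(1) one_minus] that by simp
  qed
  \<comment> \<open>This handles the differences \<open>0 - y\<close>. As \<open>1 - t\<close> is in
    \<open>H\<close>, subtracting \<open>1\<close> from it shows that \<open>-t\<close> is in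
    \<open>H\<close>, and \<open>t\<close> can be cancelled.\<close>
  have "\<ominus> \<one> \<in> H"
  proof -
    have w: "\<one> \<ominus> t \<in> H"
      using one_minus[OF t(1)] t by auto
    have "(\<one> \<ominus> t) \<ominus> \<one> = \<ominus> t"
      using H_carrier[OF t(1)] by algebra
    then have "\<ominus> t \<in> insert \<zero> H"
      using sub_H[OF w H_one] by simp
    moreover have "\<ominus> t \<noteq> \<zero>"
      using t zero_notin by auto
    ultimately have "\<ominus> t \<otimes> inv t \<in> H"
      using t by simp
    then show ?thesis
      using t by (simp add: l_minus)
  qed
  then have "\<ominus> y \<in> H" if "y \<in> H" for y
    using H_mult[of "\<ominus> \<one>" y] that by (simp add: l_minus)
  then show ?thesis
    using a b sub_H by (auto simp: minus_eq)
qed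

end

section \<open>The finite field\<close>

context cring
begin

lemma binomial:
  assumes a: "a \<in> carrier R" and b: "b \<in> carrier R"
  shows "(a \<oplus> b) [^] (n::nat) = (\<Oplus>k\<in>{..n}. add_pow R (n choose k) (a [^] k \<otimes> b [^] (n - k)))"
proof (induction n)
  case 0
  show ?case using a b by simp
next
  case (Suc n)
  define t where "t m k = a [^] k \<otimes> b [^] (m - k)" for m k :: nat
  have t: "t m k \<in> carrier R" for m k using a b by (simp add: t_def)
  have "(a \<oplus> b) [^] Suc n = (\<Oplus>k\<in>{..n}. add_pow R (n choose k) (t n k)) \<otimes> (a \<oplus> b)"
    using Suc a b by (simp add: t_def)
  also have "\<dots> = (\<Oplus>k\<in>{..n}. add_pow R (n choose k) (t n k)) \<otimes> a \<oplus> (\<Oplus>k\<in>{..n}. add_pow R (n choose k) (t n k)) \<otimes> b"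
    using a b t by (intro r_distr) auto
  also have "(\<Oplus>k\<in>{..n}. add_pow R (n choose k) (t n k)) \<otimes> a = (\<Oplus>k\<in>{..n}. add_pow R (n choose k) (t (Suc n) (Suc k)))"
  proof -
    have "t n k \<otimes> a = t (Suc n) (Suc k)" if "k \<le> n" for k
      using a b by (simp add: t_def m_ac)
    then show ?thesis
      using a t by (simp add: finsum_ldistr add_pow_ldistr cong: finsum_cong)
  qed
  \<comment> \<open>The range is extended to \<open>Suc n\<close>, where the binomial coefficient is
    zero; splitting off the index \<open>0\<close> then aligns both sums for Pascal's rule.\<close>
  also have "(\<Oplus>k\<in>{..n}. add_pow R (n choose k) (t n k)) \<otimes> b = (\<Oplus>k\<in>{..Suc n}. add_pow R (n choose k) (t (Suc n) k))"
  proof -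
    have "t n k \<otimes> b = t (Suc n) k" if "k \<le> n" for k
      using a b that by (simp add: t_def m_assoc Suc_diff_le)
    then show ?thesis
      using b t by (simp add: finsum_ldistr add_pow_ldistr binomial_eq_0 cong: finsum_cong)
  qed
  also have "\<dots> = (\<Oplus>k\<in>{..n}. add_pow R (n choose Suc k) (t (Suc n) (Suc k))) \<oplus> t (Suc n) 0"
    using t by (subst finsum_Suc2) auto
  also have "(\<Oplus>k\<in>{..n}. add_pow R (n choose k) (t (Suc n) (Suc k))) \<oplus>
      ((\<Oplus>k\<in>{..n}. add_pow R (n choose Suc k) (t (Suc n) (Suc k))) \<oplus> t (Suc n) 0)
    = (\<Oplus>k\<in>{..n}. add_pow R (Suc n choose Suc k) (t (Suc n) (Suc k))) \<oplus> t (Suc n) 0"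
    using t by (simp add: a_assoc[symmetric] finsum_addf[symmetric] add.nat_pow_mult)
  also have "\<dots> = (\<Oplus>k\<in>{..Suc n}. add_pow R (Suc n choose k) (t (Suc n) k))"
    using t by (subst finsum_Suc2) auto
  finally show ?case by (simp add: t_def)
qed

lemma add_pow_dvd_zero:
  assumes "add_pow R p \<one> = \<zero>" "p dvd (m::nat)" "x \<in> carrier R"
  shows "add_pow R m x = \<zero>"
proof -
  obtain c where m: "m = p * c" using assms(2) by blast
  have "add_pow R p x = (add_pow R p \<one>) \<otimes> x"
    using assms(3) by (simp add: add_pow_ldistr)
  then have "add_pow R p x = \<zero>" using assms(1,3) by simp
  then show ?thesis
    using assms(3) by (simp add: m add.nat_pow_pow[symmetric])
qed

text \<open>The prime \<open>p\<close> divides all binomial coefficients strictly between the ends,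
  and \<open>p\<close> annihilates the ring; only the summands with indices \<open>0\<close> and
  \<open>p\<close> survive.\<close>

lemma freshmans_dream_prime:
  assumes "Factorial_Ring.prime (p::nat)" "add_pow R p \<one> = \<zero>" and a: "a \<in> carrier R" and b: "b \<in> carrier R"
  shows "(a \<oplus> b) [^] p = a [^] p \<oplus> b [^] p"
proof -
  obtain n where p: "p = Suc n" "n > 0"
  proof
    show "p = Suc (p - 1)" "p - 1 > 0"
      using prime_gt_1_nat[OF assms(1)] by simp_all
  qed
  define t where "t k = add_pow R (p choose k) (a [^] k \<otimes> b [^] (p - k))" for k
  have t: "t k \<in> carrier R" for k using a b by (simp add: t_def)
  have "t k = \<zero>" if "0 < k" "k < p" for k
  proof -
    have "p dvd (p choose k)"
      using that assms(1) by (intro dvd_choose_prime) auto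
    then show ?thesis
      unfolding t_def using a b by (intro add_pow_dvd_zero[OF assms(2)] m_closed nat_pow_closed)
  qed
  then have z: "(\<Oplus>k\<in>{..<n}. t (Suc k)) = \<zero>"
  proof -
    have "(\<Oplus>k\<in>{..<n}. t (Suc k)) = (\<Oplus>k\<in>{..<n}. \<zero>)"
    proof (rule finsum_cong')
      show "t (Suc k) = \<zero>" if "k \<in> {..<n}" for k
        using that \<open>\<And>k. 0 < k \<Longrightarrow> k < p \<Longrightarrow> t k = \<zero>\<close> p(1) by simp
    qed auto
    then show ?thesis by simp
  qed
  have "(a \<oplus> b) [^] p = (\<Oplus>k\<in>{..Suc n}. t k)"
    unfolding t_def by (subst binomial[OF a b]) (simp add: p)
  also have "\<dots> = (\<Oplus>k\<in>{..n}. t (Suc k)) \<oplus> t 0"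
    using t by (subst finsum_Suc2) auto
  also have "{..n} = insert n {..<n}"
    by auto
  also have "(\<Oplus>k\<in>insert n {..<n}. t (Suc k)) = t p"
    using t z by (simp add: p)
  finally show ?thesis
    using a b by (simp add: t_def)
qed

lemma freshmans_dream:
  assumes "Factorial_Ring.prime (p::nat)" "add_pow R p \<one> = \<zero>" and a: "a \<in> carrier R" and b: "b \<in> carrier R"
  shows "(a \<oplus> b) [^] (p ^ n) = a [^] (p ^ n) \<oplus> b [^] (p ^ n)"
proof (induction n)
  case (Suc n)
  have "(a \<oplus> b) [^] (p ^ Suc n) = ((a \<oplus> b) [^] (p ^ n)) [^] p"
    using a b by (simp add: nat_pow_pow mult.commute)
  also have "\<dots> = (a [^] (p ^ n)) [^] p \<oplus> (b [^] (p ^ n)) [^] p"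
    unfolding Suc using a b by (intro freshmans_dream_prime assms) auto
  also have "\<dots> = a [^] (p ^ Suc n) \<oplus> b [^] (p ^ Suc n)"
    using a b by (simp add: nat_pow_pow mult.commute)
  finally show ?case .
qed (use a b in simp)

end

lemma (in cring) unit_orbits_generate:
  assumes "finite (carrier R)" "g \<in> Units R"
    and "\<And>s. s \<in> generate (units_of R) {g} \<Longrightarrow> s \<noteq> \<one> \<Longrightarrow> \<one> \<ominus> s \<in> Units R"
  shows "unit_orbits R (generate (units_of R) {g})"
proof (intro unit_orbits.intro unit_orbits_axioms.intro)
  show "subgroup (generate (units_of R) {g}) (units_of R)"
    using assms(2) units_group by (intro group.generate_is_subgroup) (auto simp: units_of_carrier)
qed (use assms cring_axioms in auto)

text \<open>Order \<open>0\<close> stands for infinite order. For an element of finite order,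
  negative exponents yield nothing beyond the natural powers.\<close>

lemma (in monoid) generate_units_pow:
  assumes "g \<in> Units G" "group.ord (units_of G) g \<noteq> 0"
  shows "generate (units_of G) {g} = range (\<lambda>k::nat. g [^] k)"
  using group.generate_pow_nat[OF units_group, of g] assms units_of_pow[OF assms(1)]
  by (auto simp: units_of_carrier)

lemma (in cring) add_pow_mult_one:
  "add_pow R (m * n :: nat) \<one> = add_pow R m \<one> \<otimes> add_pow R n \<one>"
  by (simp add: add_pow_ldistr add_pow_rdistr add.nat_pow_pow mult.commute)

text \<open>The multiple \<open>p ^ n\<close> of one is the \<open>n\<close>-th power of the
  multiple \<open>p\<close>, and a domain has no nonzero nilpotent elements.\<close>

lemma (in domain) add_pow_prime_zero:
  assumes "add_pow R (p ^ n :: nat) \<one> = \<zero>"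
  shows "add_pow R p \<one> = \<zero>"
  using assms
proof (induction n)
  case 0
  then show ?case by simp
next
  case (Suc n)
  then have "add_pow R p \<one> \<otimes> add_pow R (p ^ n) \<one> = \<zero>"
    by (simp add: add_pow_mult_one)
  then have "add_pow R p \<one> = \<zero> \<or> add_pow R (p ^ n) \<one> = \<zero>"
    by (rule integral) auto
  then show ?case using Suc.IH by blast
qed

section \<open>Cyclotomic classes as orbits\<close>

text \<open>Here \<open>e\<close> is the index and \<open>f\<close> the order of the subgroup of the
  multiplicative group; they become \<open>p ^ r + 1\<close> and \<open>p ^ r - 1\<close>.\<close>

locale cyclotomic_field = field R for R (structure) +
  fixes e f :: nat and \<alpha> :: 'a
  assumes e: "e > 0" and f: "f > 0" and card_carrier: "card (carrier R) = e * f + 1"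
    and \<alpha>: "\<alpha> \<in> carrier (Multiplicative_Group.mult_of R)"
    and generator: "generate (Multiplicative_Group.mult_of R) {\<alpha>} = carrier (Multiplicative_Group.mult_of R)"
begin

lemma finite_carrier: "finite (carrier R)"
  using card_carrier by (intro card_ge_0_finite) simp

lemma \<alpha>_Units: "\<alpha> \<in> Units R"
  using \<alpha> field_Units by simp

lemma \<alpha>_carrier [simp]: "\<alpha> \<in> carrier R"
  using \<alpha>_Units by (rule Units_closed)

lemma ord_\<alpha>: "group.ord (units_of R) \<alpha> = e * f"
proof -
  have "group.ord (units_of R) \<alpha> = card (carrier (Multiplicative_Group.mult_of R))"
    using group.generate_pow_card[OF units_group, of \<alpha>] \<alpha>_Units generator
    by (simp add: mult_of_is_Units units_of_carrier)
  also have "\<dots> = e * f"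
    using finite_carrier card_carrier by simp
  finally show ?thesis .
qed

lemma Units_eq: "Units R = range (\<lambda>t::nat. \<alpha> [^] t)"
  using generate_units_pow[OF \<alpha>_Units] ord_\<alpha> e f generator
  by (simp add: mult_of_is_Units units_of_carrier)

lemma pow_\<alpha>_eq_one: "\<alpha> [^] (n::nat) = \<one> \<longleftrightarrow> e * f dvd n"
  using group.pow_eq_id[OF units_group, of \<alpha> n] \<alpha>_Units ord_\<alpha> units_of_pow[OF \<alpha>_Units, of n]
  by (simp add: units_of_carrier units_of_one)

definition H :: "'a set" where
  "H = generate (units_of R) {\<alpha> [^] e}"

lemma \<alpha>_pow_Units: "\<alpha> [^] (n::nat) \<in> Units R"
  using \<alpha>_Units by (rule Units_pow_closed)

lemma ord_\<alpha>_pow: "group.ord (units_of R) (\<alpha> [^] e) = f"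
proof -
  have "group.ord (units_of R) (\<alpha> [^]\<^bsub>units_of R\<^esub> e) = e * f div e"
    using group.ord_pow[OF units_group, of \<alpha> e] \<alpha>_Units e by (simp add: ord_\<alpha> units_of_carrier)
  also have "\<dots> = f"
    using e by simp
  finally show ?thesis
    using units_of_pow[OF \<alpha>_Units, of "e"] by simp
qed

lemma H_eq: "H = range (\<lambda>k::nat. \<alpha> [^] (e * k))"
  unfolding H_def using generate_units_pow[OF \<alpha>_pow_Units, of "e"] ord_\<alpha>_pow f
  by (simp add: nat_pow_pow)

lemma card_H: "card H = f"
  unfolding H_def using group.generate_pow_card[OF units_group, of "\<alpha> [^] e"]
    \<alpha>_pow_Units ord_\<alpha>_pow by (simp add: units_of_carrier)

lemma unit_orbits_H: "unit_orbits R H"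
  unfolding H_def
proof (rule unit_orbits_generate[OF finite_carrier \<alpha>_pow_Units])
  fix s assume "s \<in> generate (units_of R) {\<alpha> [^] e}" "s \<noteq> \<one>"
  then have "s \<in> carrier R"
    unfolding H_def[symmetric] H_eq by auto
  then show "\<one> \<ominus> s \<in> Units R"
    using \<open>s \<noteq> \<one>\<close> by (auto simp: field_Units)
qed

sublocale orb: unit_orbits R H
  by (rule unit_orbits_H)

text \<open>The subgroup consists of all \<open>f\<close>-th roots of unity: if the exponent
  \<open>t\<close> satisfies \<open>e * f dvd t * f\<close>, then \<open>e\<close> divides
  \<open>t\<close>.\<close>

lemma H_iff: "x \<in> H \<longleftrightarrow> x \<in> carrier R \<and> x \<noteq> \<zero> \<and> x [^] f = \<one>"
proof
  assume "x \<in> H"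
  then obtain k :: nat where x: "x = \<alpha> [^] (e * k)"
    unfolding H_eq by blast
  have "x [^] f = \<alpha> [^] (e * k * f)"
    unfolding x by (rule nat_pow_pow) simp
  also have "\<dots> = \<one>"
    unfolding pow_\<alpha>_eq_one by (simp add: mult_ac)
  finally have "x [^] f = \<one>" .
  moreover have "x \<in> Units R"
    unfolding x by (rule \<alpha>_pow_Units)
  ultimately show "x \<in> carrier R \<and> x \<noteq> \<zero> \<and> x [^] f = \<one>"
    by (simp add: field_Units)
next
  assume x: "x \<in> carrier R \<and> x \<noteq> \<zero> \<and> x [^] f = \<one>"
  then have "x \<in> Units R"
    by (simp add: field_Units)
  then obtain t :: nat where t: "x = \<alpha> [^] t"
    unfolding Units_eq by blast
  have "\<alpha> [^] (t * f) = \<one>"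
    using x t nat_pow_pow[OF \<alpha>_carrier, of t "f"] by simp
  then have "e * f dvd t * f"
    unfolding pow_\<alpha>_eq_one .
  then have "e dvd t"
    using f by simp
  then show "x \<in> H"
    unfolding H_eq t by (auto elim: dvdE)
qed

text \<open>Multiplying \<open>x ^ f = 1\<close> by \<open>x\<close> admits zero as a solution. For
  \<open>f + 1 = p ^ r\<close> this describes the fixed points of a power of the Frobenius
  map.\<close>

lemma insert_zero_H_iff: "x \<in> insert \<zero> H \<longleftrightarrow> x \<in> carrier R \<and> x [^] Suc f = x"
proof (cases "x \<in> carrier R \<and> x \<noteq> \<zero>")
  case True
  then have "x [^] Suc f = x \<longleftrightarrow> x [^] f \<otimes> x = \<one> \<otimes> x"
    by simp
  also have "\<dots> \<longleftrightarrow> x [^] f = \<one>"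
    using True by (intro m_rcancel) auto
  finally show ?thesis
    using True H_iff[of x] by auto
next
  case False
  then show ?thesis
    using H_iff[of x] by (cases "x = \<zero>") auto
qed

text \<open>Splitting an exponent as \<open>t mod e\<close> plus a multiple of \<open>e\<close>
  shows that the class of \<open>i\<close> is the orbit of \<open>\<alpha> ^ i\<close>. Every
  nonzero element is a power of \<open>\<alpha>\<close>, so no further orbits exist.\<close>

lemma cyclotomic_classes_eq: "cyclotomic_classes R e \<alpha> = orb.orbits"
proof -
  have cls: "{\<alpha> [^] t | t :: nat. [t = i] (mod e)} = (\<alpha> [^] i) <# H" if i: "i < e" for i
  proof (intro equalityI subsetI)
    fix x assume "x \<in> {\<alpha> [^] t | t :: nat. [t = i] (mod e)}"
    then obtain t where t: "x = \<alpha> [^] t" "t mod e = i"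
      using i by (auto simp: cong_def)
    have "t = i + e * (t div e)"
      unfolding t(2)[symmetric] by simp
    then have "x = \<alpha> [^] i \<otimes> \<alpha> [^] (e * (t div e))"
      unfolding t(1) using nat_pow_mult[OF \<alpha>_carrier] by metis
    moreover have "\<alpha> [^] (e * (t div e)) \<in> H"
      unfolding H_eq by blast
    ultimately show "x \<in> (\<alpha> [^] i) <# H"
      unfolding orb.orbit_eq by blast
  next
    fix x assume "x \<in> (\<alpha> [^] i) <# H"
    then obtain h where "h \<in> H" "x = \<alpha> [^] i \<otimes> h"
      unfolding orb.orbit_eq by blast
    then obtain k where "x = \<alpha> [^] i \<otimes> \<alpha> [^] (e * k)"
      unfolding H_eq by blast
    then have "x = \<alpha> [^] (i + e * k)"
      using nat_pow_mult[OF \<alpha>_carrier] by simp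
    moreover have "[i + e * k = i] (mod e)"
      by (simp add: cong_def)
    ultimately show "x \<in> {\<alpha> [^] t | t :: nat. [t = i] (mod e)}"
      by blast
  qed
  have orb: "(\<alpha> [^] t) <# H = (\<alpha> [^] (t mod e)) <# H" for t :: nat
  proof -
    have "\<alpha> [^] t = \<alpha> [^] (t mod e) \<otimes> \<alpha> [^] (e * (t div e))"
      using nat_pow_mult[OF \<alpha>_carrier] by (metis mod_mult_div_eq)
    moreover have "\<alpha> [^] (e * (t div e)) \<in> H"
      unfolding H_eq by blast
    ultimately show ?thesis
      using orb.orbit_mult by simp
  qed
  have "orb.orbits = (\<lambda>t::nat. (\<alpha> [^] t) <# H) ` UNIV"
    unfolding orb.orbits_def field_Units[symmetric] Units_eq by (simp add: image_image)
  also have "\<dots> = (\<lambda>t. (\<alpha> [^] t) <# H) ` {..<e}"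
  proof (intro equalityI subsetI)
    fix D assume "D \<in> (\<lambda>t::nat. (\<alpha> [^] t) <# H) ` UNIV"
    then obtain t :: nat where "D = (\<alpha> [^] (t mod e)) <# H"
      using orb by blast
    moreover have "t mod e \<in> {..<e}" using e by simp
    ultimately show "D \<in> (\<lambda>t. (\<alpha> [^] t) <# H) ` {..<e}" by blast
  qed auto
  also have "\<dots> = cyclotomic_classes R e \<alpha>"
    unfolding cyclotomic_classes_def using cls by (auto simp: image_iff)
  finally show ?thesis by simp
qed

text \<open>The additive order of one divides the order of the field, so the characteristic is
  \<open>p\<close>; the fixed points of the additive map raising to the power \<open>p ^ r\<close>
  are closed under subtraction.\<close>

lemma closed_minus:
  assumes p: "Factorial_Ring.prime (p::nat)" and f_eq: "Suc f = p ^ r" and card_eq: "card (carrier R) = p ^ n"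
    and a: "a \<in> insert \<zero> H" and b: "b \<in> insert \<zero> H"
  shows "a \<ominus> b \<in> insert \<zero> H"
proof -
  have "add_pow R (card (carrier R)) \<one> = \<zero>"
    using add.pow_order_eq_1[OF one_closed] by (simp add: order_def)
  then have "add_pow R (p ^ n) \<one> = \<zero>"
    by (simp only: card_eq)
  then have char: "add_pow R p \<one> = \<zero>"
    by (rule add_pow_prime_zero)
  have ab: "a \<in> carrier R" "b \<in> carrier R" "a [^] Suc f = a" "b [^] Suc f = b"
    using a b unfolding insert_zero_H_iff by blast+
  \<comment> \<open>Applying the additive map to this sum avoids evaluating the power of
    \<open>-b\<close>, whose sign would depend on the parity of \<open>p\<close>.\<close>
  have "(a \<ominus> b) \<oplus> b = a"
    using ab by (simp add: minus_eq a_assoc l_neg)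
  then have "(a \<ominus> b) [^] Suc f \<oplus> b [^] Suc f = a [^] Suc f"
    using freshmans_dream[OF p char, of "a \<ominus> b" b r] ab by (simp only: f_eq minus_closed simp_thms \<open>(a \<ominus> b) \<oplus> b = a\<close>)
  then have "(a \<ominus> b) [^] Suc f \<oplus> b = (a \<ominus> b) \<oplus> b"
    using ab \<open>(a \<ominus> b) \<oplus> b = a\<close> by (simp only:)
  then have "(a \<ominus> b) [^] Suc f = a \<ominus> b"
    using ab add.r_cancel[of "(a \<ominus> b) [^] Suc f" b "a \<ominus> b"] by (simp only: nat_pow_closed minus_closed)
  then show ?thesis
    unfolding insert_zero_H_iff using ab minus_closed by blast
qed

end

section \<open>Rings with a Teichmuller set\<close>

text \<open>The properties of the Galois ring on which the argument rests, detached from its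
  construction by polynomials: \<open>\<pi>\<close> is the element \<open>p\<close>, its square
  vanishes, and everything outside its multiples is a unit.\<close>

locale teichmuller_ring = cring R for R (structure) +
  fixes p r :: nat and \<xi> :: 'a and \<pi> :: 'a
  assumes prime_p: "Factorial_Ring.prime p" and r: "r \<ge> 1" and pr: "p ^ r \<ge> 2"
    and card_carrier: "card (carrier R) = p ^ (2 * r)"
    and \<pi>_def: "\<pi> = add_pow R p \<one>"
    and \<pi>_square: "\<pi> \<otimes> \<pi> = \<zero>" and \<pi>_nonzero: "\<pi> \<noteq> \<zero>"
    and unit: "a \<in> carrier R \<Longrightarrow> a \<notin> (\<lambda>b. \<pi> \<otimes> b) ` carrier R \<Longrightarrow> a \<in> Units R"
    and \<xi>: "\<xi> \<in> Units R" and ord_\<xi>: "group.ord (units_of R) \<xi> = p ^ r - 1"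
begin

definition M :: "'a set" where
  "M = (\<lambda>b. \<pi> \<otimes> b) ` carrier R"

definition H :: "'a set" where
  "H = generate (units_of R) {\<xi>}"

lemma finite_carrier: "finite (carrier R)"
  using card_carrier prime_gt_0_nat[OF prime_p] by (intro card_ge_0_finite) simp

lemma \<pi>_carrier [simp]: "\<pi> \<in> carrier R"
  by (simp add: \<pi>_def)

lemma M_carrier: "M \<subseteq> carrier R"
  by (auto simp: M_def)

text \<open>\<open>M\<close> is both the image and the kernel of multiplication by
  \<open>\<pi>\<close>: a unit cannot annihilate the nonzero \<open>\<pi>\<close>, and the multiples
  of \<open>\<pi>\<close> are annihilated because its square is zero.\<close>

lemma \<pi>_mult_eq_zero_iff:
  assumes "a \<in> carrier R"
  shows "\<pi> \<otimes> a = \<zero> \<longleftrightarrow> a \<in> M"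
proof
  assume 0: "\<pi> \<otimes> a = \<zero>"
  show "a \<in> M"
  proof (rule ccontr)
    assume "a \<notin> M"
    then have a: "a \<in> Units R"
      using unit[OF assms] by (simp add: M_def)
    have "\<pi> = \<pi> \<otimes> a \<otimes> inv a"
      using a by (simp add: m_assoc Units_closed)
    then show False
      using 0 a \<pi>_nonzero by simp
  qed
next
  assume "a \<in> M"
  then obtain b where b: "b \<in> carrier R" "a = \<pi> \<otimes> b"
    by (auto simp: M_def)
  have "\<pi> \<otimes> (\<pi> \<otimes> b) = \<pi> \<otimes> \<pi> \<otimes> b"
    using b(1) by (simp add: m_assoc)
  then show "\<pi> \<otimes> a = \<zero>"
    using b \<pi>_square by simp
qed

lemma Units_eq: "Units R = carrier R - M"
proof (intro equalityI subsetI)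
  fix a assume a: "a \<in> Units R"
  have "\<pi> \<otimes> a \<noteq> \<zero>"
  proof
    assume "\<pi> \<otimes> a = \<zero>"
    then have "\<pi> \<otimes> a \<otimes> inv a = \<zero>"
      using a by simp
    then show False
      using a \<pi>_nonzero by (simp add: m_assoc Units_closed)
  qed
  then show "a \<in> carrier R - M"
    using \<pi>_mult_eq_zero_iff[of a] a by (simp add: Units_closed)
next
  fix a assume "a \<in> carrier R - M"
  then show "a \<in> Units R"
    using unit[of a] unfolding M_def by blast
qed

lemma M_minus: "a \<in> M \<Longrightarrow> b \<in> M \<Longrightarrow> a \<ominus> b \<in> M"
proof -
  assume "a \<in> M" "b \<in> M"
  then obtain c d where "c \<in> carrier R" "a = \<pi> \<otimes> c" "d \<in> carrier R" "b = \<pi> \<otimes> d"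
    by (auto simp: M_def)
  then have "a \<ominus> b = \<pi> \<otimes> (c \<ominus> d)" "c \<ominus> d \<in> carrier R"
    by (simp_all add: minus_eq r_distr r_minus)
  then show "a \<ominus> b \<in> M"
    unfolding M_def by (rule image_eqI)
qed

lemma \<pi>_mult_M: "a \<in> carrier R \<Longrightarrow> \<pi> \<otimes> a \<in> M"
  by (auto simp: M_def)

text \<open>Multiplication by \<open>\<pi>\<close> has image \<open>M\<close>, and its fibres over
  \<open>M\<close> are cosets of its kernel, again \<open>M\<close>. So the ring has
  \<open>card M\<close> squared elements.\<close>

lemma card_M: "card M = p ^ r"
proof -
  have fib: "card {a \<in> carrier R. \<pi> \<otimes> a = y} = card M" if y: "y \<in> M" for y
  proof -
    obtain c where c: "c \<in> carrier R" "y = \<pi> \<otimes> c"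
      using y by (auto simp: M_def)
    have "{a \<in> carrier R. \<pi> \<otimes> a = y} = (\<lambda>m. c \<oplus> m) ` M"
    proof (intro equalityI subsetI)
      fix a assume "a \<in> {a \<in> carrier R. \<pi> \<otimes> a = y}"
      then have a: "a \<in> carrier R" "\<pi> \<otimes> a = \<pi> \<otimes> c"
        using c by auto
      then have "\<pi> \<otimes> (a \<ominus> c) = \<zero>"
        using c by (simp add: minus_eq r_distr r_minus r_neg)
      then have "a \<ominus> c \<in> M"
        using \<pi>_mult_eq_zero_iff[of "a \<ominus> c"] a c by simp
      moreover have "a = c \<oplus> (a \<ominus> c)"
        using a c by (simp add: minus_eq a_lcomm r_neg)
      ultimately show "a \<in> (\<lambda>m. c \<oplus> m) ` M"
        by blast
    next
      fix a assume "a \<in> (\<lambda>m. c \<oplus> m) ` M"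
      then obtain m where m: "m \<in> M" "a = c \<oplus> m" by blast
      then have "m \<in> carrier R" "\<pi> \<otimes> m = \<zero>"
        using M_carrier \<pi>_mult_eq_zero_iff by auto
      then show "a \<in> {a \<in> carrier R. \<pi> \<otimes> a = y}"
        using m c by (simp add: r_distr)
    qed
    moreover have "inj_on (\<lambda>m. c \<oplus> m) M"
      using c M_carrier by (intro inj_onI) (simp add: subset_iff)
    ultimately show ?thesis
      by (simp add: card_image)
  qed
  have "card (carrier R) = (\<Sum>y\<in>M. card {a \<in> carrier R. \<pi> \<otimes> a = y})"
    unfolding card_eq_sum M_def by (rule sum.image_gen[OF finite_carrier])
  also have "\<dots> = card M * card M"
    using fib by simp
  finally have "(card M)\<^sup>2 = (p ^ r)\<^sup>2"
    using card_carrier by (simp add: power2_eq_square mult_2 power_add)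
  then show ?thesis
    by (simp add: power2_eq_iff_nonneg)
qed

section \<open>The group of nonzero Teichmuller elements\<close>

lemma H_eq: "H = range (\<lambda>k::nat. \<xi> [^] k)"
  unfolding H_def using pr by (intro generate_units_pow[OF \<xi>]) (simp add: ord_\<xi>)

lemma card_H: "card H = p ^ r - 1"
  unfolding H_def using group.generate_pow_card[OF units_group, of \<xi>] \<xi> ord_\<xi>
  by (simp add: units_of_carrier)

lemma \<xi>_pow_ord: "\<xi> [^] (p ^ r - 1) = \<one>"
  using group.pow_ord_eq_1[OF units_group, of \<xi>] \<xi> ord_\<xi> units_of_pow[OF \<xi>, of "p ^ r - 1"]
  by (simp add: units_of_carrier units_of_one)

text \<open>The square of an element of \<open>M\<close> vanishes, so only the constant and linear
  terms of the binomial expansion remain.\<close>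

lemma one_plus_M_pow:
  assumes "m \<in> M"
  shows "(\<one> \<oplus> m) [^] (n::nat) = \<one> \<oplus> add_pow R n m"
proof (induction n)
  case (Suc n)
  obtain b where b: "b \<in> carrier R" "m = \<pi> \<otimes> b"
    using assms by (auto simp: M_def)
  have "m \<otimes> m = (\<pi> \<otimes> \<pi>) \<otimes> (b \<otimes> b)"
    unfolding b(2) using b(1) by (simp add: m_ac)
  then have mm: "m \<otimes> m = \<zero>" and m: "m \<in> carrier R"
    using b \<pi>_square by simp_all
  have "(\<one> \<oplus> m) [^] Suc n = (\<one> \<oplus> add_pow R n m) \<otimes> (\<one> \<oplus> m)"
    using Suc by simp
  also have "\<dots> = \<one> \<oplus> add_pow R n m \<oplus> (m \<oplus> add_pow R n (m \<otimes> m))"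
    using m by (simp add: r_distr l_distr add_pow_ldistr)
  finally show ?case
    using m mm by (simp add: a_ac)
qed simp

text \<open>Otherwise \<open>s = 1 + m\<close> with \<open>m\<close> in \<open>M\<close>, and
  \<open>s ^ p = 1 + p m = 1\<close>. Then the powers of \<open>s\<close> with the consecutive
  exponents \<open>p ^ r - 1\<close> and \<open>p ^ r\<close> are both one, which forces
  \<open>s = 1\<close>.\<close>

lemma diff_unit_H:
  assumes "s \<in> H" "s \<noteq> \<one>"
  shows "\<one> \<ominus> s \<in> Units R"
proof (rule ccontr)
  assume not_unit: "\<one> \<ominus> s \<notin> Units R"
  obtain k :: nat where k: "s = \<xi> [^] k"
    using assms(1) unfolding H_eq by blast
  then have s: "s \<in> carrier R"
    using \<xi> by (simp add: Units_closed)
  have "s [^] (p ^ r - 1) = (\<xi> [^] (p ^ r - 1)) [^] k"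
    using \<xi> by (simp add: k nat_pow_pow Units_closed mult.commute)
  then have 1: "s [^] (p ^ r - 1) = \<one>"
    unfolding \<xi>_pow_ord by simp
  have "\<one> \<ominus> s \<in> M"
    using not_unit s by (simp add: Units_eq)
  then have "\<zero> \<ominus> (\<one> \<ominus> s) \<in> M"
    using M_minus[of "\<zero>"] \<pi>_mult_M[of \<zero>] by simp
  define m where "m = \<zero> \<ominus> (\<one> \<ominus> s)"
  have m: "m \<in> M" "m \<in> carrier R"
    using \<open>\<zero> \<ominus> (\<one> \<ominus> s) \<in> M\<close> M_carrier by (auto simp: m_def)
  have "\<one> \<oplus> m = s"
    unfolding m_def using s by (simp add: minus_eq minus_add r_neg2)
  have "add_pow R p m = \<pi> \<otimes> m"
    using m by (simp add: \<pi>_def add_pow_ldistr)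
  also have "\<dots> = \<zero>"
    using m \<pi>_mult_eq_zero_iff by simp
  finally have "s [^] p = \<one>"
    using one_plus_M_pow[OF m(1), of p] by (simp add: \<open>\<one> \<oplus> m = s\<close>)
  then have "s [^] (p * p ^ (r - 1)) = \<one>"
    using nat_pow_pow[OF s, of p "p ^ (r - 1)"] by simp
  moreover have "p * p ^ (r - 1) = p ^ r"
    using r by (cases r) auto
  moreover have "Suc (p ^ r - 1) = p ^ r"
    using pr by simp
  ultimately have "s [^] Suc (p ^ r - 1) = \<one>"
    by (simp only:)
  then show False
    using 1 s assms(2) by simp
qed

lemma unit_orbits_H: "unit_orbits R H"
  using finite_carrier \<xi> diff_unit_H unfolding H_def by (rule unit_orbits_generate)

sublocale orb: unit_orbits R H
  by (rule unit_orbits_H)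

lemma zero_notin_H: "\<zero> \<notin> H"
  using orb.H_Units \<pi>_mult_M[OF zero_closed] by (auto simp: Units_eq)

lemma teichmuller_set_eq: "teichmuller_set R (p ^ r - 1) \<xi> = insert \<zero> H"
proof -
  have "\<xi> [^] k \<in> {\<xi> [^] i | i :: nat. i < p ^ r - 1}" for k :: nat
  proof -
    define n where "n = p ^ r - 1"
    have n: "n > 0" "\<xi> [^] n = \<one>"
      using pr \<xi>_pow_ord by (simp_all add: n_def)
    have "\<xi> [^] k = \<xi> [^] (n * (k div n) + k mod n)"
      by simp
    also have "\<dots> = (\<xi> [^] n) [^] (k div n) \<otimes> \<xi> [^] (k mod n)"
      using \<xi> by (simp add: nat_pow_mult nat_pow_pow Units_closed del: mult_div_mod_eq)
    finally have "\<xi> [^] k = \<xi> [^] (k mod n)"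
      using \<xi> by (simp add: n Units_closed)
    moreover have "k mod n < n"
      using n by simp
    ultimately show ?thesis
      unfolding n_def by blast
  qed
  then show ?thesis
    unfolding teichmuller_set_def H_eq by auto
qed

section \<open>The Teichmuller family as the set of orbits\<close>

lemma one_plus_\<pi>_Units:
  assumes "a \<in> carrier R"
  shows "\<one> \<oplus> \<pi> \<otimes> a \<in> Units R"
proof (rule ccontr)
  assume "\<one> \<oplus> \<pi> \<otimes> a \<notin> Units R"
  then have "(\<one> \<oplus> \<pi> \<otimes> a) \<ominus> \<pi> \<otimes> a \<in> M"
    using assms \<pi>_mult_M by (intro M_minus) (simp_all add: Units_eq)
  moreover have "(\<one> \<oplus> \<pi> \<otimes> a) \<ominus> \<pi> \<otimes> a = \<one>"
    using assms by (simp add: minus_eq a_assoc r_neg)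
  ultimately show False
    using Units_one_closed unfolding Units_eq by simp
qed

text \<open>Modulo \<open>M\<close> the products reduce to \<open>h\<close> and \<open>g\<close>,
  and distinct elements of \<open>H\<close> differ by a unit, so \<open>h = g\<close>. After
  cancelling, \<open>\<pi> (a - b) = 0\<close> puts \<open>a - b\<close> into \<open>M\<close>, and
  the same reasoning gives \<open>a = b\<close>.\<close>

lemma inj_on_decomposition:
  "inj_on (\<lambda>(a, h). (\<one> \<oplus> \<pi> \<otimes> a) \<otimes> h) (insert \<zero> H \<times> H)"
proof (intro inj_onI, clarify)
  fix a h b g
  assume ab: "a \<in> insert \<zero> H" "b \<in> insert \<zero> H" and hg: "h \<in> H" "g \<in> H"
    and eq: "(\<one> \<oplus> \<pi> \<otimes> a) \<otimes> h = (\<one> \<oplus> \<pi> \<otimes> b) \<otimes> g"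
  have c: "a \<in> carrier R" "b \<in> carrier R" "h \<in> carrier R" "g \<in> carrier R"
    using ab hg by auto
  have "h \<ominus> g = ((\<one> \<oplus> \<pi> \<otimes> a) \<otimes> h \<ominus> \<pi> \<otimes> a \<otimes> h) \<ominus> ((\<one> \<oplus> \<pi> \<otimes> b) \<otimes> g \<ominus> \<pi> \<otimes> b \<otimes> g)"
    using c \<pi>_carrier by algebra
  also have "\<dots> = \<pi> \<otimes> (b \<otimes> g \<ominus> a \<otimes> h)"
    unfolding eq using c \<pi>_carrier by algebra
  finally have "h \<ominus> g \<in> M"
    using c \<pi>_mult_M by simp
  then have hg_eq: "h = g"
    using orb.minus_Units[of h g] hg by (auto simp: Units_eq)
  then have "\<one> \<oplus> \<pi> \<otimes> a = \<one> \<oplus> \<pi> \<otimes> b"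
  proof -
    have "(\<one> \<oplus> \<pi> \<otimes> a) \<otimes> h \<otimes> inv h = (\<one> \<oplus> \<pi> \<otimes> b) \<otimes> h \<otimes> inv h"
      using eq hg_eq by simp
    then show ?thesis
      using c hg by (simp add: m_assoc)
  qed
  then have "\<pi> \<otimes> (a \<ominus> b) = \<zero>"
    using c by (simp add: minus_eq r_distr r_minus r_neg)
  then have "a \<ominus> b \<in> M"
    using \<pi>_mult_eq_zero_iff c by simp
  then have "a = b"
    using orb.minus_Units[OF ab] by (auto simp: Units_eq)
  then show "a = b \<and> h = g"
    using hg_eq by simp
qed

text \<open>An injection between finite sets of equal size: there are
  \<open>p ^ (2 * r) - p ^ r\<close> units, which is the number \<open>p ^ r * (p ^ r - 1)\<close>
  of pairs.\<close>

lemma Units_decomposition: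
  "(\<lambda>(a, h). (\<one> \<oplus> \<pi> \<otimes> a) \<otimes> h) ` (insert \<zero> H \<times> H) = Units R"
proof (rule card_subset_eq)
  show "finite (Units R)"
    using finite_carrier by (simp add: Units_eq)
  show "(\<lambda>(a, h). (\<one> \<oplus> \<pi> \<otimes> a) \<otimes> h) ` (insert \<zero> H \<times> H) \<subseteq> Units R"
  proof clarify
    fix a h assume "a \<in> insert \<zero> H" "h \<in> H"
    moreover from this have "a \<in> carrier R" by auto
    ultimately show "(\<one> \<oplus> \<pi> \<otimes> a) \<otimes> h \<in> Units R"
      by (intro Units_m_closed one_plus_\<pi>_Units orb.H_Units)
  qed
  have "card (Units R) = p ^ (2 * r) - p ^ r"
    unfolding Units_eq card_M[symmetric] card_carrier[symmetric]
    using M_carrier finite_subset[OF M_carrier finite_carrier] by (intro card_Diff_subset)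
  also have "\<dots> = p ^ r * (p ^ r - 1)"
    by (simp add: mult_2 power_add diff_mult_distrib2)
  also have "\<dots> = card (insert \<zero> H \<times> H)"
  proof -
    have "card (insert \<zero> H) = p ^ r"
      using zero_notin_H orb.finite_H card_H pr by simp
    then show ?thesis
      by (simp only: card_cartesian_product card_H)
  qed
  finally show "card ((\<lambda>(a, h). (\<one> \<oplus> \<pi> \<otimes> a) \<otimes> h) ` (insert \<zero> H \<times> H)) = card (Units R)"
    using card_image[OF inj_on_decomposition] by simp
qed

text \<open>By the decomposition of the units, a unit lies in the orbit of some
  \<open>1 + \<pi> a\<close>. The nonzero elements of \<open>M\<close> form a single further orbit,
  that of \<open>\<pi>\<close>.\<close>

lemma teichmuller_family_eq:
  "teichmuller_family R p (teichmuller_set R (p ^ r - 1) \<xi>) = orb.orbits"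
proof -
  have "teichmuller_family R p (teichmuller_set R (p ^ r - 1) \<xi>) =
      {(\<one> \<oplus> \<pi> \<otimes> a) <# H | a. a \<in> insert \<zero> H} \<union> {\<pi> <# H}"
    using zero_notin_H unfolding teichmuller_family_def teichmuller_set_eq \<pi>_def by simp
  also have "\<dots> = orb.orbits"
  proof (intro equalityI subsetI)
    fix D assume "D \<in> {(\<one> \<oplus> \<pi> \<otimes> a) <# H | a. a \<in> insert \<zero> H} \<union> {\<pi> <# H}"
    then consider a where "a \<in> insert \<zero> H" "D = (\<one> \<oplus> \<pi> \<otimes> a) <# H" | "D = \<pi> <# H"
      by blast
    then show "D \<in> orb.orbits"
    proof cases
      case 1
      then have "\<one> \<oplus> \<pi> \<otimes> a \<in> Units R"
        by (intro one_plus_\<pi>_Units) auto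
      then have "\<one> \<oplus> \<pi> \<otimes> a \<in> carrier R - {\<zero>}"
        using \<pi>_mult_M[OF zero_closed] by (auto simp: Units_eq)
      then show ?thesis
        unfolding orb.orbits_def 1(2) by (rule imageI)
    next
      case 2
      then show ?thesis
        using \<pi>_nonzero by (simp add: orb.orbits_def)
    qed
  next
    fix D assume "D \<in> orb.orbits"
    then obtain x where x: "x \<in> carrier R" "x \<noteq> \<zero>" "D = x <# H"
      by (rule orb.orbitsE)
    show "D \<in> {(\<one> \<oplus> \<pi> \<otimes> a) <# H | a. a \<in> insert \<zero> H} \<union> {\<pi> <# H}"
    proof (cases "x \<in> M")
      case True
      have fin: "finite M"
        using M_carrier finite_carrier by (rule finite_subset)
      have "\<pi> <# H = M - {\<zero>}"
      \<comment> \<open>The orbit of \<open>\<pi>\<close> is contained in the nonzero part of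
        \<open>M\<close>, and both have \<open>p ^ r - 1\<close> elements.\<close>
      proof (rule card_subset_eq)
        show "finite (M - {\<zero>})"
          using fin by simp
        show "\<pi> <# H \<subseteq> M - {\<zero>}"
          using orb.orbit_nonzero(2)[OF \<pi>_carrier \<pi>_nonzero] \<pi>_mult_M
          unfolding orb.orbit_eq by auto
        show "card (\<pi> <# H) = card (M - {\<zero>})"
          using orb.card_orbit[OF \<pi>_carrier \<pi>_nonzero] card_H card_M \<pi>_mult_M[OF zero_closed] fin
          by simp
      qed
      then have "D = \<pi> <# H"
        using orb.orbit_eqI[OF \<pi>_carrier, of x] True x by simp
      then show ?thesis by simp
    next
      case False
      then have "x \<in> Units R"
        using x by (simp add: Units_eq)
      then obtain a h where ah: "a \<in> insert \<zero> H" "h \<in> H" "x = (\<one> \<oplus> \<pi> \<otimes> a) \<otimes> h"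
        unfolding Units_decomposition[symmetric] by auto
      then have "D = (\<one> \<oplus> \<pi> \<otimes> a) <# H"
        using orb.orbit_mult[of "\<one> \<oplus> \<pi> \<otimes> a" h] x(3) by auto
      then show ?thesis
        using ah(1) by blast
    qed
  qed
  finally show ?thesis .
qed

lemma not_closed:
  "\<not> (\<forall>a\<in>insert \<zero> H. \<forall>b\<in>insert \<zero> H. a \<ominus> b \<in> insert \<zero> H)"
proof
  assume "\<forall>a\<in>insert \<zero> H. \<forall>b\<in>insert \<zero> H. a \<ominus> b \<in> insert \<zero> H"
  then have "\<pi> \<in> insert \<zero> H"
    unfolding \<pi>_def by (intro orb.closed_imp_add_pow_mem) blast
  then have "\<pi> \<in> Units R"
    using \<pi>_nonzero orb.H_Units by blast
  then show False
    using \<pi>_mult_M[OF one_closed] by (simp add: Units_eq)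
qed

end

section \<open>Galois rings\<close>

text \<open>Long division over a commutative ring first multiplies the dividend by a power of the
  leading coefficient of the divisor; over a field this factor can be inverted.\<close>

lemma euclidean_domain_UP:
  assumes "field K"
  shows "euclidean_domain (UP K) (deg K)"
proof -
  interpret K: field K by fact
  interpret UP_domain K "UP K"
    by (intro UP_domain.intro K.domain_axioms)
  show ?thesis
  proof (intro euclidean_domain.intro euclidean_domain_axioms.intro)
    show "domain (UP K)" by (rule UP_domain)
    fix a b assume "a \<in> carrier (UP K) - {\<zero>\<^bsub>UP K\<^esub>}" "b \<in> carrier (UP K) - {\<zero>\<^bsub>UP K\<^esub>}"
    then have a: "a \<in> carrier (UP K)" and b: "b \<in> carrier (UP K)" "b \<noteq> \<zero>\<^bsub>UP K\<^esub>"
      by auto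
    define c where "c = lcoeff b"
    obtain q s and k :: nat where qs: "q \<in> carrier (UP K)" "s \<in> carrier (UP K)"
      "c [^]\<^bsub>K\<^esub> k \<odot>\<^bsub>UP K\<^esub> a = b \<otimes>\<^bsub>UP K\<^esub> q \<oplus>\<^bsub>UP K\<^esub> s"
      "s = \<zero>\<^bsub>UP K\<^esub> \<or> deg K s < deg K b"
      using long_div_theorem[OF b(1) a b(2)] unfolding c_def by blast
    have "c \<in> carrier K" "c \<noteq> \<zero>\<^bsub>K\<^esub>"
      using b lcoeff_nonzero2 by (simp_all add: c_def)
    then have "c \<in> Units K"
      by (simp add: K.field_Units)
    then have ck: "c [^]\<^bsub>K\<^esub> k \<in> Units K"
      by (rule K.Units_pow_closed)
    define d where "d = inv\<^bsub>K\<^esub> (c [^]\<^bsub>K\<^esub> k)"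
    have d: "d \<in> carrier K" "d \<otimes>\<^bsub>K\<^esub> (c [^]\<^bsub>K\<^esub> k) = \<one>\<^bsub>K\<^esub>"
      using ck by (simp_all add: d_def)
    have ckc: "c [^]\<^bsub>K\<^esub> k \<in> carrier K"
      using ck by (rule K.Units_closed)
    have "a = d \<odot>\<^bsub>UP K\<^esub> (c [^]\<^bsub>K\<^esub> k \<odot>\<^bsub>UP K\<^esub> a)"
      using UP_smult_assoc1[OF d(1) ckc a] d(2) UP_smult_one[OF a] by simp
    also have "\<dots> = d \<odot>\<^bsub>UP K\<^esub> (b \<otimes>\<^bsub>UP K\<^esub> q) \<oplus>\<^bsub>UP K\<^esub> d \<odot>\<^bsub>UP K\<^esub> s"
      unfolding qs(3) using d(1) b(1) qs by (intro UP_smult_r_distr) auto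
    also have "d \<odot>\<^bsub>UP K\<^esub> (b \<otimes>\<^bsub>UP K\<^esub> q) = b \<otimes>\<^bsub>UP K\<^esub> (d \<odot>\<^bsub>UP K\<^esub> q)"
      using UP_smult_assoc2[OF d(1) qs(1) b(1)] b(1) qs(1) d(1) by (simp add: P.m_comm)
    finally have "a = b \<otimes>\<^bsub>UP K\<^esub> (d \<odot>\<^bsub>UP K\<^esub> q) \<oplus>\<^bsub>UP K\<^esub> d \<odot>\<^bsub>UP K\<^esub> s" .
    moreover have "d \<odot>\<^bsub>UP K\<^esub> s = \<zero>\<^bsub>UP K\<^esub> \<or> deg K (d \<odot>\<^bsub>UP K\<^esub> s) < deg K b"
    proof (cases "s = \<zero>\<^bsub>UP K\<^esub>")
      case True
      have "d \<odot>\<^bsub>UP K\<^esub> \<zero>\<^bsub>UP K\<^esub> = \<zero>\<^bsub>UP K\<^esub>"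
        using d(1) by (intro up_eqI) auto
      then show ?thesis using True by simp
    next
      case False
      then show ?thesis
        using qs(4) deg_smult_decr[OF d(1) qs(2)] by linarith
    qed
    moreover have "d \<odot>\<^bsub>UP K\<^esub> q \<in> carrier (UP K)" "d \<odot>\<^bsub>UP K\<^esub> s \<in> carrier (UP K)"
      using d(1) qs(1,2) by (auto intro: UP_smult_closed)
    ultimately show "\<exists>q s. q \<in> carrier (UP K) \<and> s \<in> carrier (UP K) \<and>
        a = b \<otimes>\<^bsub>UP K\<^esub> q \<oplus>\<^bsub>UP K\<^esub> s \<and> (s = \<zero>\<^bsub>UP K\<^esub> \<or> deg K s < deg K b)"
      by blast
  qed
qed

text \<open>The ideal of an irreducible element is maximal, so together with an outside element
  \<open>a\<close> it generates the whole ring, in particular one.\<close>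

lemma UP_irreducible_bezout:
  assumes K: "field K" and f: "f \<in> carrier (UP K)" "ring_irreducible\<^bsub>UP K\<^esub> f"
    and a: "a \<in> carrier (UP K)" "a \<notin> PIdl\<^bsub>UP K\<^esub> f"
  shows "\<exists>u\<in>carrier (UP K). \<exists>v\<in>carrier (UP K).
    a \<otimes>\<^bsub>UP K\<^esub> u \<oplus>\<^bsub>UP K\<^esub> f \<otimes>\<^bsub>UP K\<^esub> v = \<one>\<^bsub>UP K\<^esub>"
proof -
  interpret P: euclidean_domain "UP K" "deg K"
    using K by (rule euclidean_domain_UP)
  let ?I = "PIdl\<^bsub>UP K\<^esub> f" and ?J = "PIdl\<^bsub>UP K\<^esub> a"
  interpret I: maximalideal ?I "UP K"
    using f by (rule P.irreducible_imp_maximalideal)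
  have J: "ideal ?J (UP K)"
    using a(1) by (rule P.cgenideal_ideal)
  have IJ: "ideal (?I <+>\<^bsub>UP K\<^esub> ?J) (UP K)"
    using I.is_ideal J by (rule P.add_ideals)
  have "?I \<subseteq> ?I <+>\<^bsub>UP K\<^esub> ?J"
  proof
    fix x assume "x \<in> ?I"
    moreover have "\<zero>\<^bsub>UP K\<^esub> \<in> ?J"
      using J by (simp add: additive_subgroup.zero_closed ideal.axioms(1))
    moreover have "x = x \<oplus>\<^bsub>UP K\<^esub> \<zero>\<^bsub>UP K\<^esub>"
      using \<open>x \<in> ?I\<close> I.Icarr by simp
    ultimately show "x \<in> ?I <+>\<^bsub>UP K\<^esub> ?J"
      unfolding set_add_def' by blast
  qed
  moreover have "a \<in> ?I <+>\<^bsub>UP K\<^esub> ?J"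
  proof -
    have "\<zero>\<^bsub>UP K\<^esub> \<in> ?I" by simp
    moreover have "a \<in> ?J" using a(1) by (rule P.cgenideal_self)
    moreover have "a = \<zero>\<^bsub>UP K\<^esub> \<oplus>\<^bsub>UP K\<^esub> a" using a(1) by simp
    ultimately show ?thesis
      unfolding set_add_def' by blast
  qed
  ultimately have "?I <+>\<^bsub>UP K\<^esub> ?J = carrier (UP K)"
    using I.I_maximal[OF IJ] a(2) ideal.Icarr[OF IJ] by blast
  then have "\<one>\<^bsub>UP K\<^esub> \<in> ?I <+>\<^bsub>UP K\<^esub> ?J"
    by simp
  then obtain v u where "v \<in> carrier (UP K)" "u \<in> carrier (UP K)"
    "\<one>\<^bsub>UP K\<^esub> = v \<otimes>\<^bsub>UP K\<^esub> f \<oplus>\<^bsub>UP K\<^esub> u \<otimes>\<^bsub>UP K\<^esub> a"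
    unfolding set_add_def' cgenideal_def by blast
  then show ?thesis
    using f(1) a(1) by (metis P.a_comm P.m_closed P.m_comm)
qed

section \<open>Polynomials over residue rings by their integer coefficients\<close>

lemma UP_residue_carrier:
  assumes "1 < m"
  shows "g \<in> carrier (UP (residue_ring m)) \<longleftrightarrow> (\<forall>n. g n \<in> {0..<m}) \<and> (\<exists>n. \<forall>k>n. g k = 0)"
  using assms by (auto simp: UP_def up_def residue_ring_def bound_def Pi_def)

lemma UP_residue_zero: "\<zero>\<^bsub>UP (residue_ring m)\<^esub> = (\<lambda>i. 0)"
  by (simp add: UP_def residue_ring_def)

lemma UP_residue_one: "\<one>\<^bsub>UP (residue_ring m)\<^esub> = (\<lambda>i. if i = 0 then 1 else 0)"
  by (auto simp: UP_def residue_ring_def fun_eq_iff)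

lemma UP_residue_add:
  assumes "g \<in> carrier (UP (residue_ring m))" "h \<in> carrier (UP (residue_ring m))"
  shows "(g \<oplus>\<^bsub>UP (residue_ring m)\<^esub> h) n = (g n + h n) mod m"
  using assms by (simp add: UP_def residue_ring_def)

lemma UP_residue_mult:
  assumes "1 < m" "g \<in> carrier (UP (residue_ring m))" "h \<in> carrier (UP (residue_ring m))"
  shows "(g \<otimes>\<^bsub>UP (residue_ring m)\<^esub> h) n = (\<Sum>i\<le>n. g i * h (n - i)) mod m"
proof -
  interpret residues m "residue_ring m"
    using assms(1) by unfold_locales
  have "(g \<otimes>\<^bsub>UP (residue_ring m)\<^esub> h) n =
      (\<Oplus>\<^bsub>residue_ring m\<^esub>i\<in>{..n}. (g i * h (n - i)) mod m)"
    using assms(2,3) by (simp add: UP_def res_mult_eq)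
  then show ?thesis
    by (simp add: sum_cong)
qed

text \<open>The inverse is \<open>1 - y\<close>.\<close>

lemma (in cring) one_plus_Units:
  assumes "y \<in> carrier R" "y \<otimes> y = \<zero>"
  shows "\<one> \<oplus> y \<in> Units R"
proof -
  have "(\<one> \<oplus> y) \<otimes> (\<one> \<ominus> y) = \<one> \<ominus> y \<otimes> y"
    using assms(1) one_closed by algebra
  also have "\<dots> = \<one>"
    using assms(2) by (simp add: minus_eq)
  finally show ?thesis
    using assms(1) by (intro unit_factor[of "\<one> \<oplus> y" "\<one> \<ominus> y"]) simp_all
qed

section \<open>The Galois ring as a quotient ring\<close>

locale basic_irreducible =
  fixes p r :: nat and f :: "nat \<Rightarrow> int"
  assumes prime_p: "Factorial_Ring.prime p" and r: "r \<ge> 1"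
    and basic_irreducible: "monic_basic_irreducible p r f"
begin

abbreviation Z where "Z \<equiv> residue_ring (int p ^ 2)"
abbreviation K where "K \<equiv> residue_ring (int p)"
abbreviation GR where "GR \<equiv> galois_ring p f"

lemma p_gt_1: "1 < int p" "1 < int p ^ 2"
  using prime_gt_1_nat[OF prime_p] by (simp_all add: power2_eq_square less_1_mult)

lemma residues_Z: "residues (int p ^ 2)"
  using p_gt_1(2) by (rule residues.intro)

lemma field_K: "field K"
  using prime_p by (intro residues_prime.is_field residues_prime.intro)

lemma UP_cring_Z: "UP_cring Z"
  using residues.cring[OF residues_Z] by (rule UP_cring.intro)

lemma cring_UP_Z: "cring (UP Z)"
  using UP_cring.UP_cring[OF UP_cring_Z] .

lemma zero_Z: "\<zero>\<^bsub>Z\<^esub> = 0" and one_Z: "\<one>\<^bsub>Z\<^esub> = 1"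
  by (simp_all add: residue_ring_def)

lemma f_carrier: "f \<in> carrier (UP Z)" and f_deg: "deg Z f = r" and f_lead: "f r = 1"
  and f_irreducible: "ring_irreducible\<^bsub>UP K\<^esub> (\<lambda>i. f i mod int p)"
  using basic_irreducible by (auto simp: monic_basic_irreducible_def)

definition I :: "(nat \<Rightarrow> int) set" where
  "I = PIdl\<^bsub>UP Z\<^esub> f"

lemma GR_eq: "GR = UP Z Quot I"
  by (simp add: galois_ring_def I_def)

lemma ideal_I: "ideal I (UP Z)"
  unfolding I_def using f_carrier by (rule cring.cgenideal_ideal[OF cring_UP_Z])

lemma cring_GR: "cring GR"
  unfolding GR_eq by (rule ideal.quotient_is_cring[OF ideal_I cring_UP_Z])

lemma coset_hom: "(+>\<^bsub>UP Z\<^esub>) I \<in> ring_hom (UP Z) GR"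
  unfolding GR_eq by (rule ideal.rcos_ring_hom[OF ideal_I])

lemmas coset_closed = ring_hom_closed[OF coset_hom]
  and coset_add = ring_hom_add[OF coset_hom]
  and coset_mult = ring_hom_mult[OF coset_hom]
  and coset_one = ring_hom_one[OF coset_hom]
  and coset_zero = ring_hom_zero[OF coset_hom cring.axioms(1)[OF cring_UP_Z] cring.axioms(1)[OF cring_GR]]

lemma carrier_GR: "carrier GR = (\<lambda>g. I +>\<^bsub>UP Z\<^esub> g) ` carrier (UP Z)"
  by (auto simp: GR_eq FactRing_def A_RCOSETS_def')

lemma coset_eq_iff:
  assumes "g \<in> carrier (UP Z)" "g' \<in> carrier (UP Z)"
  shows "I +>\<^bsub>UP Z\<^esub> g = I +>\<^bsub>UP Z\<^esub> g' \<longleftrightarrow> g \<ominus>\<^bsub>UP Z\<^esub> g' \<in> I"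
  using ring.quotient_eq_iff_same_a_r_cos[OF cring.axioms(1)[OF cring_UP_Z] ideal_I assms] by (rule sym)

lemma coeff_UP_Z: "g \<in> carrier (UP Z) \<Longrightarrow> UnivPoly.coeff (UP Z) g n = g n"
  by (simp add: UP_def)

lemma f_above: "n > r \<Longrightarrow> f n = 0"
  using UP_ring.deg_aboveD[OF UP_ring.intro[OF cring.axioms(1)[OF residues.cring[OF residues_Z]]] _ f_carrier, of n]
    coeff_UP_Z[OF f_carrier, of n]
  unfolding f_deg zero_Z by argo

section \<open>Representatives, order and characteristic of the Galois ring\<close>

text \<open>The possible remainders on division by the monic polynomial \<open>f\<close>; they
  represent the residue classes modulo \<open>I\<close>.\<close>

definition S :: "(nat \<Rightarrow> int) set" where
  "S = {g. (\<forall>n<r. g n \<in> {0..<int p ^ 2}) \<and> (\<forall>n\<ge>r. g n = 0)}"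

lemma S_carrier: "S \<subseteq> carrier (UP Z)"
proof
  fix g assume g: "g \<in> S"
  then have "g n \<in> {0..<int p ^ 2}" for n
    using prime_gt_0_nat[OF prime_p] by (cases "n < r") (auto simp: S_def)
  moreover have "\<forall>k>r. g k = 0"
    using g by (auto simp: S_def)
  ultimately show "g \<in> carrier (UP Z)"
    unfolding UP_residue_carrier[OF p_gt_1(2)] by (intro conjI allI exI[of _ r]) simp_all
qed

text \<open>The leading coefficient of \<open>f\<close> is one, so it does not annihilate the
  coefficient of \<open>x\<close> at \<open>d\<close>, even though the base ring has zero
  divisors.\<close>

lemma mult_f_coeff:
  assumes x: "x \<in> carrier (UP Z)" and above: "\<And>k. k > d \<Longrightarrow> x k = 0"
  shows "(x \<otimes>\<^bsub>UP Z\<^esub> f) (d + r) = x d"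
proof -
  \<comment> \<open>For \<open>i < d\<close> the index into \<open>f\<close> exceeds
    \<open>r\<close>, and for \<open>i > d\<close> the coefficient of \<open>x\<close> is
    zero.\<close>
  have "x i * f (d + r - i) = (if i = d then x d else 0)" if "i \<le> d + r" for i
    using above[of i] f_above[of "d + r - i"] f_lead that by (cases i d rule: linorder_cases) auto
  then have "(\<Sum>i\<le>d + r. x i * f (d + r - i)) = (\<Sum>i\<le>d + r. if i = d then x d else 0)"
    by (intro sum.cong) auto
  then have "(x \<otimes>\<^bsub>UP Z\<^esub> f) (d + r) = x d mod int p ^ 2"
    using UP_residue_mult[OF p_gt_1(2) x f_carrier] by simp
  also have "\<dots> = x d"
    using x UP_residue_carrier[OF p_gt_1(2), of x] by auto
  finally show ?thesis .
qed

text \<open>The difference of two congruent representatives is \<open>x f\<close>. If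
  \<open>x\<close> had degree \<open>d\<close>, its leading coefficient would reappear at
  \<open>d + r\<close>, where the difference is zero.\<close>

lemma inj_on_S: "inj_on (\<lambda>g. I +>\<^bsub>UP Z\<^esub> g) S"
proof (rule inj_onI)
  interpret P: cring "UP Z" by (rule cring_UP_Z)
  fix g g' assume g: "g \<in> S" "g' \<in> S" and eq: "I +>\<^bsub>UP Z\<^esub> g = I +>\<^bsub>UP Z\<^esub> g'"
  have gc: "g \<in> carrier (UP Z)" "g' \<in> carrier (UP Z)"
    using g S_carrier by auto
  then have "g \<ominus>\<^bsub>UP Z\<^esub> g' \<in> I"
    using eq coset_eq_iff by blast
  then obtain x where x: "x \<in> carrier (UP Z)" "g \<ominus>\<^bsub>UP Z\<^esub> g' = x \<otimes>\<^bsub>UP Z\<^esub> f"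
    unfolding I_def cgenideal_def by blast
  have "x = (\<lambda>i. 0)"
  proof (rule ccontr)
    assume "x \<noteq> (\<lambda>i. 0)"
    then have ex: "{i. x i \<noteq> 0} \<noteq> {}" by auto
    obtain b where "\<forall>k>b. x k = 0"
      using x(1) UP_residue_carrier[OF p_gt_1(2), of x] by blast
    then have "{i. x i \<noteq> 0} \<subseteq> {..b}"
      by (auto simp: not_less[symmetric])
    then have fin: "finite {i. x i \<noteq> 0}"
      by (rule finite_subset) simp
    define d where "d = Max {i. x i \<noteq> 0}"
    have "d \<in> {i. x i \<noteq> 0}"
      unfolding d_def using fin ex by (rule Max_in)
    then have "x d \<noteq> 0" by simp
    have "x k = 0" if "k > d" for k
      using Max_ge[OF fin, of k] that unfolding d_def by auto
    then have "(g \<ominus>\<^bsub>UP Z\<^esub> g') (d + r) = x d"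
      unfolding x(2) by (rule mult_f_coeff[OF x(1)])
    moreover have "(g \<ominus>\<^bsub>UP Z\<^esub> g') (d + r) = 0"
    proof -
      have "g = (g \<ominus>\<^bsub>UP Z\<^esub> g') \<oplus>\<^bsub>UP Z\<^esub> g'"
        using gc by (simp add: P.minus_eq P.a_assoc P.l_neg)
      moreover have "((g \<ominus>\<^bsub>UP Z\<^esub> g') \<oplus>\<^bsub>UP Z\<^esub> g') (d + r) =
          ((g \<ominus>\<^bsub>UP Z\<^esub> g') (d + r) + g' (d + r)) mod int p ^ 2"
        by (rule UP_residue_add[OF P.minus_closed[OF gc] gc(2)])
      ultimately have "g (d + r) = ((g \<ominus>\<^bsub>UP Z\<^esub> g') (d + r) + g' (d + r)) mod int p ^ 2"
        by (simp only:)
      then have "(g \<ominus>\<^bsub>UP Z\<^esub> g') (d + r) mod int p ^ 2 = 0"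
        using g by (simp add: S_def)
      moreover have "(g \<ominus>\<^bsub>UP Z\<^esub> g') (d + r) \<in> {0..<int p ^ 2}"
        using gc UP_residue_carrier[OF p_gt_1(2), of "g \<ominus>\<^bsub>UP Z\<^esub> g'"] by blast
      ultimately show ?thesis by simp
    qed
    ultimately show False
      using \<open>x d \<noteq> 0\<close> by simp
  qed
  then have "x = \<zero>\<^bsub>UP Z\<^esub>"
    by (simp add: UP_residue_zero)
  then have "g \<ominus>\<^bsub>UP Z\<^esub> g' = \<zero>\<^bsub>UP Z\<^esub>"
    using x(2) P.l_null[OF f_carrier] by simp
  then show "g = g'"
    using gc by simp
qed

lemma image_S: "(\<lambda>g. I +>\<^bsub>UP Z\<^esub> g) ` S = carrier GR"
proof (intro equalityI subsetI)
  fix a assume "a \<in> (\<lambda>g. I +>\<^bsub>UP Z\<^esub> g) ` S"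
  then show "a \<in> carrier GR"
    unfolding carrier_GR using S_carrier by blast
next
  interpret P: cring "UP Z" by (rule cring_UP_Z)
  interpret U: UP_cring Z "UP Z" by (rule UP_cring_Z)
  fix a assume "a \<in> carrier GR"
  then obtain A where A: "A \<in> carrier (UP Z)" "a = I +>\<^bsub>UP Z\<^esub> A"
    unfolding carrier_GR by blast
  have "f \<noteq> \<zero>\<^bsub>UP Z\<^esub>"
    using f_lead by (auto simp: UP_residue_zero)
  then obtain q s and k :: nat where qs: "q \<in> carrier (UP Z)" "s \<in> carrier (UP Z)"
    "UnivPoly.coeff (UP Z) f (deg Z f) [^]\<^bsub>Z\<^esub> k \<odot>\<^bsub>UP Z\<^esub> A = f \<otimes>\<^bsub>UP Z\<^esub> q \<oplus>\<^bsub>UP Z\<^esub> s"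
    "s = \<zero>\<^bsub>UP Z\<^esub> \<or> deg Z s < deg Z f"
    using U.long_div_theorem[OF f_carrier A(1)] by blast
  \<comment> \<open>The factor in front of the dividend is thus one, and the division is an ordinary
    one.\<close>
  have "UnivPoly.coeff (UP Z) f (deg Z f) = \<one>\<^bsub>Z\<^esub>"
    using coeff_UP_Z[OF f_carrier] f_deg f_lead by (simp add: one_Z)
  then have As: "A = f \<otimes>\<^bsub>UP Z\<^esub> q \<oplus>\<^bsub>UP Z\<^esub> s"
    using qs(3) U.UP_smult_one[OF A(1)] by simp
  have "s n = 0" if "n \<ge> r" for n
    using qs(4)
  proof
    assume "deg Z s < deg Z f"
    then show ?thesis
      using U.deg_aboveD[OF _ qs(2), of n] that f_deg coeff_UP_Z[OF qs(2), of n]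
      by (simp add: zero_Z)
  qed (simp add: UP_residue_zero)
  then have sS: "s \<in> S"
    using qs(2) UP_residue_carrier[OF p_gt_1(2), of s] by (simp add: S_def)
  have "A \<ominus>\<^bsub>UP Z\<^esub> s = q \<otimes>\<^bsub>UP Z\<^esub> f"
    unfolding As using qs f_carrier by (simp add: P.minus_eq P.a_assoc P.r_neg P.m_comm)
  then have "A \<ominus>\<^bsub>UP Z\<^esub> s \<in> I"
    unfolding I_def cgenideal_def using qs(1) by blast
  then have "a = I +>\<^bsub>UP Z\<^esub> s"
    using coset_eq_iff[OF A(1) qs(2)] A(2) by simp
  then show "a \<in> (\<lambda>g. I +>\<^bsub>UP Z\<^esub> g) ` S"
    using sS by blast
qed

lemma card_S: "card S = p ^ (2 * r)"
proof -
  \<comment> \<open>\<open>restrict\<close> trades the zeros from \<open>r\<close> on for the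
    \<open>undefined\<close> values of extensional functions, which are the functions that
    \<open>card_PiE\<close> counts.\<close>
  have "bij_betw (\<lambda>g. restrict g {..<r}) S ({..<r} \<rightarrow>\<^sub>E {0..<int p ^ 2})"
    by (rule bij_betw_byWitness[where f' = "\<lambda>g n. if n < r then g n else 0"])
      (auto simp: S_def fun_eq_iff PiE_def extensional_def Pi_def)
  then have "card S = card ({..<r} \<rightarrow>\<^sub>E {0..<int p ^ 2})"
    by (rule bij_betw_same_card)
  also have "\<dots> = nat (int p ^ 2) ^ r"
    by (simp add: card_PiE)
  also have "nat (int p ^ 2) = p ^ 2"
    by (metis nat_int of_nat_power)
  finally show ?thesis
    by (simp add: power_mult)
qed

lemma card_GR: "card (carrier GR) = p ^ (2 * r)"
  unfolding image_S[symmetric] using card_image[OF inj_on_S] card_S by simp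

text \<open>As \<open>r \<ge> 1\<close>, constants lie in \<open>S\<close>; so two multiples of one
  in the Galois ring are equal exactly when their constants are.\<close>

definition const :: "int \<Rightarrow> nat \<Rightarrow> int" where
  "const a = (\<lambda>i. if i = 0 then a mod int p ^ 2 else 0)"

lemma const_S: "const a \<in> S"
  using r prime_gt_0_nat[OF prime_p] by (auto simp: S_def const_def)

lemma const_carrier [simp]: "const a \<in> carrier (UP Z)"
  using const_S S_carrier by blast

lemma add_pow_GR_one: "add_pow GR n \<one>\<^bsub>GR\<^esub> = I +>\<^bsub>UP Z\<^esub> const (int n)"
proof (induction n)
  interpret GR: cring GR by (rule cring_GR)
  case 0
  have "const 0 = \<zero>\<^bsub>UP Z\<^esub>"
    by (simp add: const_def UP_residue_zero fun_eq_iff)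
  then show ?case
    by (simp add: coset_zero)
next
  case (Suc n)
  interpret P: cring "UP Z" by (rule cring_UP_Z)
  interpret GR: cring GR by (rule cring_GR)
  have "const (int (Suc n)) = const (int n) \<oplus>\<^bsub>UP Z\<^esub> \<one>\<^bsub>UP Z\<^esub>"
    by (rule ext, subst UP_residue_add[OF const_carrier P.one_closed])
      (auto simp: const_def UP_residue_one mod_simps add.commute)
  then have "I +>\<^bsub>UP Z\<^esub> const (int (Suc n)) = (I +>\<^bsub>UP Z\<^esub> const (int n)) \<oplus>\<^bsub>GR\<^esub> \<one>\<^bsub>GR\<^esub>"
    using coset_add[OF const_carrier P.one_closed] by (simp add: coset_one)
  then show ?case
    using Suc by simp
qed

lemma add_pow_GR_eq_zero_iff: "add_pow GR n \<one>\<^bsub>GR\<^esub> = \<zero>\<^bsub>GR\<^esub> \<longleftrightarrow> p ^ 2 dvd n"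
proof -
  have zero: "const 0 = \<zero>\<^bsub>UP Z\<^esub>"
    by (simp add: const_def UP_residue_zero fun_eq_iff)
  then have "\<zero>\<^bsub>GR\<^esub> = I +>\<^bsub>UP Z\<^esub> const 0"
    by (simp add: coset_zero)
  then have "add_pow GR n \<one>\<^bsub>GR\<^esub> = \<zero>\<^bsub>GR\<^esub> \<longleftrightarrow> const (int n) = const 0"
    using inj_on_eq_iff[OF inj_on_S const_S const_S] add_pow_GR_one by simp
  also have "\<dots> \<longleftrightarrow> int n mod int p ^ 2 = 0"
    by (auto simp: const_def fun_eq_iff)
  also have "\<dots> \<longleftrightarrow> p ^ 2 dvd n"
    by (metis dvd_eq_mod_eq_0 of_nat_dvd_iff of_nat_power)
  finally show ?thesis .
qed

section \<open>Reduction modulo p and lifting of units\<close>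

definition red :: "(nat \<Rightarrow> int) \<Rightarrow> nat \<Rightarrow> int" where
  "red g = (\<lambda>i. g i mod int p)"

lemma red_carrier: "g \<in> carrier (UP Z) \<Longrightarrow> red g \<in> carrier (UP K)"
proof -
  assume "g \<in> carrier (UP Z)"
  then obtain n where "\<forall>k>n. g k = 0"
    unfolding UP_residue_carrier[OF p_gt_1(2)] by blast
  then have "\<forall>k>n. red g k = 0"
    by (simp add: red_def)
  moreover have "\<forall>n. red g n \<in> {0..<int p}"
    using p_gt_1(1) by (simp add: red_def)
  ultimately show "red g \<in> carrier (UP K)"
    unfolding UP_residue_carrier[OF p_gt_1(1)] by blast
qed

lemma mod_square_mod: "(a mod int p ^ 2) mod int p = a mod int p"
  by (rule mod_mod_cancel) (simp add: power2_eq_square)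

lemma red_add:
  assumes "g \<in> carrier (UP Z)" "h \<in> carrier (UP Z)"
  shows "red (g \<oplus>\<^bsub>UP Z\<^esub> h) = red g \<oplus>\<^bsub>UP K\<^esub> red h"
proof
  fix n
  show "red (g \<oplus>\<^bsub>UP Z\<^esub> h) n = (red g \<oplus>\<^bsub>UP K\<^esub> red h) n"
    using UP_residue_add[OF assms] UP_residue_add[OF assms[THEN red_carrier]]
    by (simp add: red_def mod_square_mod mod_simps)
qed

lemma red_mult:
  assumes "g \<in> carrier (UP Z)" "h \<in> carrier (UP Z)"
  shows "red (g \<otimes>\<^bsub>UP Z\<^esub> h) = red g \<otimes>\<^bsub>UP K\<^esub> red h"
proof
  fix n
  have "red (g \<otimes>\<^bsub>UP Z\<^esub> h) n = (\<Sum>i\<le>n. g i * h (n - i)) mod int p"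
    using UP_residue_mult[OF p_gt_1(2) assms] by (simp add: red_def mod_square_mod)
  also have "\<dots> = (\<Sum>i\<le>n. (g i * h (n - i)) mod int p) mod int p"
    by (rule mod_sum_eq[symmetric])
  also have "\<dots> = (\<Sum>i\<le>n. (red g i * red h (n - i)) mod int p) mod int p"
    by (simp add: red_def mod_mult_eq)
  also have "\<dots> = (\<Sum>i\<le>n. red g i * red h (n - i)) mod int p"
    by (rule mod_sum_eq)
  also have "\<dots> = (red g \<otimes>\<^bsub>UP K\<^esub> red h) n"
    using UP_residue_mult[OF p_gt_1(1) assms[THEN red_carrier]] by simp
  finally show "red (g \<otimes>\<^bsub>UP Z\<^esub> h) n = (red g \<otimes>\<^bsub>UP K\<^esub> red h) n" .
qed

text \<open>Residues modulo \<open>p\<close> are integers below \<open>p\<close>, hence also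
  residues modulo \<open>p ^ 2\<close>, so a polynomial over \<open>K\<close> is its own
  lift.\<close>

lemma red_lift:
  assumes "g \<in> carrier (UP K)"
  shows "g \<in> carrier (UP Z)" "red g = g"
proof -
  have g: "\<forall>n. g n \<in> {0..<int p}" "\<exists>n. \<forall>k>n. g k = 0"
    using assms UP_residue_carrier[OF p_gt_1(1), of g] by blast+
  have "int p \<le> int p ^ 2"
    using p_gt_1(1) by (simp add: power2_eq_square)
  then have "\<forall>n. g n \<in> {0..<int p ^ 2}"
    using g(1) by (meson atLeastLessThan_iff order_less_le_trans)
  then show "g \<in> carrier (UP Z)"
    using g(2) UP_residue_carrier[OF p_gt_1(2), of g] by blast
  show "red g = g"
    using g(1) by (simp add: red_def)
qed

text \<open>The kernel of reduction consists of the multiples of \<open>p\<close>; the cofactor is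
  found coefficientwise.\<close>

lemma red_eq_imp_const_mult:
  assumes "g \<in> carrier (UP Z)" "h \<in> carrier (UP Z)" "red g = red h"
  shows "\<exists>w\<in>carrier (UP Z). g = h \<oplus>\<^bsub>UP Z\<^esub> const (int p) \<otimes>\<^bsub>UP Z\<^esub> w"
proof -
  \<comment> \<open>The quotient may be negative; the outer reduction brings it into the range of
    coefficients.\<close>
  define w where "w = (\<lambda>i. ((g i - h i) div int p) mod int p ^ 2)"
  obtain a b where "\<forall>k>a. g k = 0" "\<forall>k>b. h k = 0"
    using assms UP_residue_carrier[OF p_gt_1(2)] by blast
  then have "\<forall>k>max a b. w k = 0"
    by (simp add: w_def)
  moreover have "\<forall>n. w n \<in> {0..<int p ^ 2}"
    using prime_gt_0_nat[OF prime_p] by (simp add: w_def)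
  ultimately have w: "w \<in> carrier (UP Z)"
    using UP_residue_carrier[OF p_gt_1(2), of w] by blast
  have "g n = (h \<oplus>\<^bsub>UP Z\<^esub> const (int p) \<otimes>\<^bsub>UP Z\<^esub> w) n" for n
  proof -
    have "(\<Sum>i\<le>n. const (int p) i * w (n - i)) = (\<Sum>i\<le>n. if i = 0 then const (int p) 0 * w n else 0)"
      by (intro sum.cong) (auto simp: const_def)
    then have c: "(const (int p) \<otimes>\<^bsub>UP Z\<^esub> w) n = (const (int p) 0 * w n) mod int p ^ 2"
      using UP_residue_mult[OF p_gt_1(2) const_carrier w] by simp
    have "int p dvd g n - h n"
      using fun_cong[OF assms(3), of n] by (simp add: red_def mod_eq_dvd_iff)
    then have "int p * ((g n - h n) div int p) = g n - h n"
      by simp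
    then have "(const (int p) 0 * w n) mod int p ^ 2 = (g n - h n) mod int p ^ 2"
      by (simp add: const_def w_def mod_simps)
    then have "(h \<oplus>\<^bsub>UP Z\<^esub> const (int p) \<otimes>\<^bsub>UP Z\<^esub> w) n = (h n + (g n - h n)) mod int p ^ 2"
      using UP_residue_add[OF assms(2) monoid.m_closed[OF ring.is_monoid[OF cring.axioms(1)[OF cring_UP_Z]] const_carrier w], where n = n] c
      by (simp add: mod_simps)
    also have "\<dots> = g n"
      using assms(1) UP_residue_carrier[OF p_gt_1(2), of g] by simp
    finally show ?thesis by simp
  qed
  then show ?thesis
    using w by blast
qed

abbreviation \<pi> where "\<pi> \<equiv> add_pow GR p \<one>\<^bsub>GR\<^esub>"

lemma \<pi>_square: "\<pi> \<otimes>\<^bsub>GR\<^esub> \<pi> = \<zero>\<^bsub>GR\<^esub>"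
proof -
  interpret GR: cring GR by (rule cring_GR)
  have "\<pi> \<otimes>\<^bsub>GR\<^esub> \<pi> = add_pow GR (p * p) \<one>\<^bsub>GR\<^esub>"
    by (simp add: GR.add_pow_ldistr GR.add_pow_rdistr GR.add.nat_pow_pow)
  then show ?thesis
    by (simp add: add_pow_GR_eq_zero_iff power2_eq_square)
qed

text \<open>If a representative \<open>A\<close> reduces into the ideal of \<open>red f\<close>,
  then \<open>A\<close> is a multiple of \<open>f\<close> plus a multiple of \<open>p\<close>, so
  \<open>a\<close> is a multiple of \<open>\<pi>\<close>. Otherwise a Bezout identity modulo
  \<open>p\<close> lifts to \<open>a u = 1 + y\<close> with \<open>y\<close> a multiple of
  \<open>\<pi>\<close>, and the right-hand side is a unit because \<open>y\<close> has square
  zero.\<close>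

lemma GR_unit:
  assumes a: "a \<in> carrier GR" "a \<notin> (\<lambda>b. \<pi> \<otimes>\<^bsub>GR\<^esub> b) ` carrier GR"
  shows "a \<in> Units GR"
proof -
  interpret P: cring "UP Z" by (rule cring_UP_Z)
  interpret GR: cring GR by (rule cring_GR)
  obtain A where A: "A \<in> carrier (UP Z)" "a = I +>\<^bsub>UP Z\<^esub> A"
    using a(1) unfolding carrier_GR by blast
  have red_f: "red f = (\<lambda>i. f i mod int p)"
    by (simp add: red_def)
  have f_zero: "I +>\<^bsub>UP Z\<^esub> f = \<zero>\<^bsub>GR\<^esub>"
    using P.a_rcos_zero[OF ideal_I, of f] P.cgenideal_self[OF f_carrier]
    by (simp add: I_def GR_eq FactRing_def)
  have "red A \<notin> PIdl\<^bsub>UP K\<^esub> (red f)"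
  proof
    assume "red A \<in> PIdl\<^bsub>UP K\<^esub> (red f)"
    then obtain B where B: "B \<in> carrier (UP K)" "red A = B \<otimes>\<^bsub>UP K\<^esub> red f"
      unfolding cgenideal_def by blast
    have "red A = red (B \<otimes>\<^bsub>UP Z\<^esub> f)"
      using red_mult[OF red_lift(1)[OF B(1)] f_carrier] red_lift(2)[OF B(1)] B(2) by simp
    then obtain w where w: "w \<in> carrier (UP Z)"
      "A = B \<otimes>\<^bsub>UP Z\<^esub> f \<oplus>\<^bsub>UP Z\<^esub> const (int p) \<otimes>\<^bsub>UP Z\<^esub> w"
      using red_eq_imp_const_mult[OF A(1), of "B \<otimes>\<^bsub>UP Z\<^esub> f"] red_lift(1)[OF B(1)] f_carrier by auto
    have "a = \<pi> \<otimes>\<^bsub>GR\<^esub> (I +>\<^bsub>UP Z\<^esub> w)"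
      unfolding A(2) w(2) add_pow_GR_one
      using red_lift(1)[OF B(1)] f_carrier w(1) f_zero by (simp add: coset_closed coset_add coset_mult)
    moreover have "I +>\<^bsub>UP Z\<^esub> w \<in> carrier GR"
      using w(1) by (rule coset_closed)
    ultimately show False
      using a(2) by blast
  qed
  then obtain U V where U: "U \<in> carrier (UP K)" and V: "V \<in> carrier (UP K)"
    and UV: "red A \<otimes>\<^bsub>UP K\<^esub> U \<oplus>\<^bsub>UP K\<^esub> red f \<otimes>\<^bsub>UP K\<^esub> V = \<one>\<^bsub>UP K\<^esub>"
    using UP_irreducible_bezout[OF field_K red_carrier[OF f_carrier] _ red_carrier[OF A(1)]]
      f_irreducible red_f by auto
  note UZ = red_lift(1)[OF U] and VZ = red_lift(1)[OF V]
  define u where "u = I +>\<^bsub>UP Z\<^esub> U"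
  have u: "u \<in> carrier GR"
    unfolding u_def using UZ by (rule coset_closed)
  \<comment> \<open>The lifted identity is correct only modulo \<open>p\<close>; the error is the
    multiple of \<open>p\<close> extracted next.\<close>
  have "red (A \<otimes>\<^bsub>UP Z\<^esub> U \<oplus>\<^bsub>UP Z\<^esub> f \<otimes>\<^bsub>UP Z\<^esub> V) = \<one>\<^bsub>UP K\<^esub>"
    using A(1) UZ VZ f_carrier UV red_lift(2)[OF U] red_lift(2)[OF V]
    by (simp add: red_add red_mult)
  also have "\<dots> = red \<one>\<^bsub>UP Z\<^esub>"
    using p_gt_1(1) by (simp add: UP_residue_one red_def fun_eq_iff)
  finally obtain w where w: "w \<in> carrier (UP Z)"
    "A \<otimes>\<^bsub>UP Z\<^esub> U \<oplus>\<^bsub>UP Z\<^esub> f \<otimes>\<^bsub>UP Z\<^esub> V = \<one>\<^bsub>UP Z\<^esub> \<oplus>\<^bsub>UP Z\<^esub> const (int p) \<otimes>\<^bsub>UP Z\<^esub> w"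
    using red_eq_imp_const_mult[of "A \<otimes>\<^bsub>UP Z\<^esub> U \<oplus>\<^bsub>UP Z\<^esub> f \<otimes>\<^bsub>UP Z\<^esub> V" "\<one>\<^bsub>UP Z\<^esub>"] A(1) UZ VZ f_carrier
    by auto
  define y where "y = \<pi> \<otimes>\<^bsub>GR\<^esub> (I +>\<^bsub>UP Z\<^esub> w)"
  have wc: "I +>\<^bsub>UP Z\<^esub> w \<in> carrier GR"
    using w(1) by (rule coset_closed)
  then have y: "y \<in> carrier GR"
    by (simp add: y_def)
  have "I +>\<^bsub>UP Z\<^esub> (A \<otimes>\<^bsub>UP Z\<^esub> U \<oplus>\<^bsub>UP Z\<^esub> f \<otimes>\<^bsub>UP Z\<^esub> V) = a \<otimes>\<^bsub>GR\<^esub> u"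
    unfolding A(2) u_def using A(1) UZ VZ f_carrier f_zero by (simp add: coset_closed coset_add coset_mult)
  moreover have "I +>\<^bsub>UP Z\<^esub> (A \<otimes>\<^bsub>UP Z\<^esub> U \<oplus>\<^bsub>UP Z\<^esub> f \<otimes>\<^bsub>UP Z\<^esub> V) = \<one>\<^bsub>GR\<^esub> \<oplus>\<^bsub>GR\<^esub> y"
    unfolding w(2) y_def add_pow_GR_one using w(1)
    by (simp add: coset_closed coset_add coset_mult coset_one)
  ultimately have au: "a \<otimes>\<^bsub>GR\<^esub> u = \<one>\<^bsub>GR\<^esub> \<oplus>\<^bsub>GR\<^esub> y"
    by simp
  have "y \<otimes>\<^bsub>GR\<^esub> y = (\<pi> \<otimes>\<^bsub>GR\<^esub> \<pi>) \<otimes>\<^bsub>GR\<^esub> ((I +>\<^bsub>UP Z\<^esub> w) \<otimes>\<^bsub>GR\<^esub> (I +>\<^bsub>UP Z\<^esub> w))"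
    unfolding y_def using wc by (simp add: GR.m_ac)
  also have "\<dots> = \<zero>\<^bsub>GR\<^esub>"
    unfolding \<pi>_square using wc by simp
  finally have yy: "y \<otimes>\<^bsub>GR\<^esub> y = \<zero>\<^bsub>GR\<^esub>" .
  have "a \<otimes>\<^bsub>GR\<^esub> u \<in> Units GR"
    unfolding au using y yy by (rule GR.one_plus_Units)
  then show ?thesis
    using a(1) u by (rule GR.unit_factor)
qed

end

section \<open>The theorem\<close>

text \<open>The field, its generator, the basic irreducible polynomial and the unit of order
  \<open>p ^ r - 1\<close> are arbitrary, so the result is independent of all choices in both
  constructions.\<close>

theorem theorem5p4:
  fixes p r :: nat
    and F :: "('a, 'b) ring_scheme" and \<alpha> :: 'a
    and f :: "nat \<Rightarrow> int" and \<xi> :: "(nat \<Rightarrow> int) set"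
  defines "R \<equiv> galois_ring p f"
  defines "C \<equiv> cyclotomic_classes F (p ^ r + 1) \<alpha>"
  defines "E \<equiv> teichmuller_family R p (teichmuller_set R (p ^ r - 1) \<xi>)"
  assumes "Factorial_Ring.prime p" and "r \<ge> 1" and "p ^ r \<ge> 3"
    and "field F" and "card (carrier F) = p ^ (2 * r)"
    and "\<alpha> \<in> carrier (Multiplicative_Group.mult_of F)"
    and "generate (Multiplicative_Group.mult_of F) {\<alpha>} = carrier (Multiplicative_Group.mult_of F)"
    and "monic_basic_irreducible p r f"
    and "\<xi> \<in> Units R" and "group.ord (units_of R) \<xi> = p ^ r - 1"
  shows "disjoint_difference_family F (p ^ (2 * r)) (p ^ r - 1) (p ^ r - 2) C \<and>
    disjoint_difference_family R (p ^ (2 * r)) (p ^ r - 1) (p ^ r - 2) E \<and>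
    two_design (p ^ (2 * r)) (p ^ r - 1) (p ^ r - 2) (dev F C) \<and>
    two_design (p ^ (2 * r)) (p ^ r - 1) (p ^ r - 2) (dev R E) \<and>
    (p = 3 \<and> r = 1 \<longrightarrow> isomorphic_designs (dev F C) (dev R E)) \<and>
    (\<not> (p = 3 \<and> r = 1) \<longrightarrow> \<not> isomorphic_designs (dev F C) (dev R E))"
proof -
  define q where "q = p ^ r"
  have q: "q \<ge> 3" "p ^ (2 * r) = q * q"
    using assms(6) by (simp_all add: q_def mult_2 power_add)
  interpret F: cyclotomic_field F "q + 1" "q - 1" \<alpha>
  proof (intro cyclotomic_field.intro cyclotomic_field_axioms.intro)
    have "q * q = (q + 1) * (q - 1) + 1"
      using q(1) by (cases q) (auto simp: algebra_simps)
    then show "card (carrier F) = (q + 1) * (q - 1) + 1"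
      using assms(8) q(2) by simp
  qed (use q assms in auto)
  interpret G: basic_irreducible p r f
    using assms by (intro basic_irreducible.intro)
  interpret T: teichmuller_ring R p r \<xi> "add_pow R p \<one>\<^bsub>R\<^esub>"
  proof (intro teichmuller_ring.intro teichmuller_ring_axioms.intro)
    show "cring R" "card (carrier R) = p ^ (2 * r)"
      unfolding R_def by (rule G.cring_GR G.card_GR)+
    show "add_pow R p \<one>\<^bsub>R\<^esub> \<otimes>\<^bsub>R\<^esub> add_pow R p \<one>\<^bsub>R\<^esub> = \<zero>\<^bsub>R\<^esub>"
      unfolding R_def by (rule G.\<pi>_square)
    have "\<not> p ^ 2 dvd p"
      using prime_gt_1_nat[OF assms(4)] by (auto simp: power2_eq_square dest: dvd_imp_le)
    then show "add_pow R p \<one>\<^bsub>R\<^esub> \<noteq> \<zero>\<^bsub>R\<^esub>"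
      unfolding R_def G.add_pow_GR_eq_zero_iff .
    show "a \<in> Units R"
      if "a \<in> carrier R" "a \<notin> (\<lambda>b. add_pow R p \<one>\<^bsub>R\<^esub> \<otimes>\<^bsub>R\<^esub> b) ` carrier R" for a
      using that unfolding R_def by (rule G.GR_unit)
  qed (use assms in auto)
  have C: "C = F.orb.orbits"
    unfolding C_def q_def[symmetric] by (rule F.cyclotomic_classes_eq)
  have E: "E = T.orb.orbits"
    unfolding E_def by (rule T.teichmuller_family_eq)
  have ddf_C: "disjoint_difference_family F (p ^ (2 * r)) (p ^ r - 1) (p ^ r - 2) C"
    using F.orb.disjoint_difference_family_orbits
    unfolding C F.card_H assms(8) by (simp only: q_def diff_diff_left one_add_one)
  have ddf_E: "disjoint_difference_family R (p ^ (2 * r)) (p ^ r - 1) (p ^ r - 2) E"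
    using T.orb.disjoint_difference_family_orbits
    unfolding E T.card_H T.card_carrier by (simp only: diff_diff_left one_add_one)
  note designs = ddf_C[THEN two_design_dev] ddf_E[THEN two_design_dev]
  \<comment> \<open>Here both designs have nine points, blocks of size two and
    \<open>\<lambda> = 1\<close>.\<close>
  have iso: "isomorphic_designs (dev F C) (dev R E)" if "p = 3 \<and> r = 1"
    using designs that by (intro isomorphic_designs_block_size_2[of 9 1]) simp_all
  have noniso: "\<not> isomorphic_designs (dev F C) (dev R E)" if not3: "\<not> (p = 3 \<and> r = 1)"
  proof
    assume isomorphic: "isomorphic_designs (dev F C) (dev R E)"
    \<comment> \<open>Since \<open>p ^ r = 3\<close> forces \<open>p = 3\<close> and
      \<open>r = 1\<close>, the remaining cases have \<open>q \<ge> 4\<close> and blocks with at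
      least three points.\<close>
    have "q \<noteq> 3"
    proof
      assume "q = 3"
      then have "p dvd 3"
        using assms(5) unfolding q_def by (metis dvd_power less_eq_Suc_le One_nat_def)
      then have "p = 3"
        using primes_dvd_imp_eq[OF assms(4), of 3] by simp
      then have "(3::nat) ^ r = 3 ^ 1"
        using \<open>q = 3\<close> by (simp add: q_def)
      then have "r = 1"
        by (simp only: power_inject_exp)
      then show False
        using \<open>p = 3\<close> not3 by simp
    qed
    have "uniquely_completable (dev F F.orb.orbits)"
    proof (rule F.orb.uniquely_completable_if_closed)
      show "card F.H \<ge> 3"
        unfolding F.card_H using q \<open>q \<noteq> 3\<close> by simp
      show "a \<ominus>\<^bsub>F\<^esub> b \<in> insert \<zero>\<^bsub>F\<^esub> F.H"
        if "a \<in> insert \<zero>\<^bsub>F\<^esub> F.H" "b \<in> insert \<zero>\<^bsub>F\<^esub> F.H" for a b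
      proof (rule F.closed_minus[OF assms(4) _ assms(8) that])
        show "Suc (q - 1) = p ^ r"
          using q(1) by (simp add: q_def)
      qed
    qed
    then have R: "uniquely_completable (dev R T.orb.orbits)"
      using F.orb.dev_orbits_subset
      by (rule uniquely_completable_isomorphic[OF isomorphic[unfolded C E]])
    \<comment> \<open>A nontrivial \<open>t\<close> in \<open>H\<close> is needed as the ratio of
      the homotheties.\<close>
    have "\<not> card T.H \<le> Suc 0"
      using q \<open>q \<noteq> 3\<close> by (simp add: T.card_H flip: q_def)
    then obtain t where t: "t \<in> T.H" "t \<noteq> \<one>\<^bsub>R\<^esub>"
      using card_le_Suc0_iff_eq[OF T.orb.finite_H] by metis
    have "\<forall>a\<in>insert \<zero>\<^bsub>R\<^esub> T.H. \<forall>b\<in>insert \<zero>\<^bsub>R\<^esub> T.H. a \<ominus>\<^bsub>R\<^esub> b \<in> insert \<zero>\<^bsub>R\<^esub> T.H"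
      using T.orb.closed_if_uniquely_completable[OF R t] by blast
    then show False
      using T.not_closed by contradiction
  qed
  show ?thesis
    using ddf_C ddf_E designs iso noniso by blast
qed

end
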